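(* Let $f\in\mathcal{HK}$. The Dirichlet problem of finding $u:D\to\mathbb{R}$ such that (i) $u\in C^2(D)$, (ii) $\Delta u=0$ in $D$, (iii) $\|u_r-f\|\to0$ as $r\to1$, has the unique solution $u=P[f]$.
   Context: $D$ is the open unit disc in $\mathbb{R}^2$; for $u:D\to\mathbb{R}$ write $u_r(\theta)=u(re^{i\theta})$. $\mathcal{HK}$ is the set of $2\pi$-periodic functions $f:\mathbb{R}\to\mathbb{R}$ that are Henstock--Kurzweil integrable over a period, equivalently with finite Alexiewicz norm $\|f\|:=\sup_I|\int_I f|$, the supremum being over intervals $I\subset\mathbb{R}$ of length at most $2\pi$. The symbol $\|\cdot\|$ is the Alexiewicz norm. The Poisson kernel is $\Phi_r(\theta)=\frac{1-r^2}{2\pi(1-2r\cos\theta+r^2)}$ and the Poisson integral of $f$ is $P[f](re^{i\theta})=\int_{-\pi}^{\pi}f(\phi)\Phi_r(\phi-\theta)\,d\phi$ (a Henstock--Kurzweil integral). Limits $r\to1$ are from below. *)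

theory Defs
  imports "HOL-Analysis.Analysis"
begin

definition HK :: "(real \<Rightarrow> real) set" where
  "HK = {f. (\<forall>x. f (x + 2 * pi) = f x) \<and> f integrable_on {-pi..pi}}"

text \<open>
  Compact intervals suffice, since the endpoints do not affect the integral. For functions
  in \<^const>\<open>HK\<close> the integrals are bounded, so that the real supremum is meaningful.
\<close>

definition alexiewicz_norm :: "(real \<Rightarrow> real) \<Rightarrow> real" where
  "alexiewicz_norm f =
     (SUP (a, b) \<in> {(a, b). a \<le> b \<and> b - a \<le> 2 * pi}. \<bar>integral {a..b} f\<bar>)"

definition poisson_kernel :: "real \<Rightarrow> real \<Rightarrow> real" where
  "poisson_kernel r \<theta> = (1 - r\<^sup>2) / (2 * pi * (1 - 2 * r * cos \<theta> + r\<^sup>2))"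

definition poisson_integral :: "(real \<Rightarrow> real) \<Rightarrow> complex \<Rightarrow> real" where
  "poisson_integral f z =
     integral {-pi..pi} (\<lambda>\<phi>. f \<phi> * poisson_kernel (cmod z) (\<phi> - Arg z))"

text \<open>The value does not depend on the choice of polar coordinates.\<close>

lemma poisson_integral_rcis:
  assumes "0 \<le> r"
  shows "poisson_integral f (rcis r \<theta>) =
           integral {-pi..pi} (\<lambda>\<phi>. f \<phi> * poisson_kernel r (\<phi> - \<theta>))"
proof (cases "r = 0")
  case True
  then show ?thesis
    by (simp add: poisson_integral_def poisson_kernel_def)
next
  case False
  with assms have r: "r > 0" by simp
  have norm: "cmod (rcis r \<theta>) = r"
    using assms by simp
  have "rcis r (Arg (rcis r \<theta>)) = rcis r \<theta>"
    using rcis_cmod_Arg[of "rcis r \<theta>"] norm by simp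
  then have "cis (Arg (rcis r \<theta>)) = cis \<theta>"
    using r by (simp add: rcis_def)
  then have "cos (Arg (rcis r \<theta>)) = cos \<theta>" "sin (Arg (rcis r \<theta>)) = sin \<theta>"
    by (simp_all add: complex_eq_iff)
  then have "cos (\<phi> - Arg (rcis r \<theta>)) = cos (\<phi> - \<theta>)" for \<phi>
    by (simp add: cos_diff)
  then show ?thesis
    unfolding poisson_integral_def poisson_kernel_def norm by simp
qed

definition partial_deriv :: "'a::euclidean_space \<Rightarrow> ('a \<Rightarrow> real) \<Rightarrow> 'a \<Rightarrow> real" where
  "partial_deriv b u x = deriv (\<lambda>t. u (x + t *\<^sub>R b)) 0"

text \<open>
  All partial derivatives of order at most \<open>k\<close> exist and are continuous; meant for open \<open>S\<close>.
\<close>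

primrec Ck_on :: "nat \<Rightarrow> ('a::euclidean_space \<Rightarrow> real) \<Rightarrow> 'a set \<Rightarrow> bool" where
  "Ck_on 0 u S \<longleftrightarrow> continuous_on S u"
| "Ck_on (Suc k) u S \<longleftrightarrow>
     continuous_on S u \<and>
     (\<forall>b\<in>Basis. (\<forall>x\<in>S. (\<lambda>t. u (x + t *\<^sub>R b)) field_differentiable at 0) \<and>
                Ck_on k (partial_deriv b u) S)"

definition laplacian :: "('a::euclidean_space \<Rightarrow> real) \<Rightarrow> 'a \<Rightarrow> real" where
  "laplacian u x = (\<Sum>b\<in>Basis. partial_deriv b (partial_deriv b u) x)"

text \<open>
  The plane is identified with \<^typ>\<open>complex\<close>, whose \<^const>\<open>Basis\<close> is \<open>{1, \<i>}\<close>. Only the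
  values of \<open>u\<close> on the open unit disc matter.
\<close>

definition dirichlet_solution :: "(real \<Rightarrow> real) \<Rightarrow> (complex \<Rightarrow> real) \<Rightarrow> bool" where
  "dirichlet_solution f u \<longleftrightarrow>
     Ck_on 2 u (ball 0 1) \<and>
     (\<forall>z\<in>ball 0 1. laplacian u z = 0) \<and>
     ((\<lambda>r. alexiewicz_norm (\<lambda>\<theta>. u (rcis r \<theta>) - f \<theta>)) \<longlongrightarrow> 0) (at_left 1)"

end

theory Submission
  imports Defs "HOL-Complex_Analysis.Cauchy_Integral_Formula"
begin

text \<open>
  Let \<open>c\<close> be the mean of \<open>f\<close> and \<open>F\<close> a primitive of \<open>f - c\<close>, which is continuous and periodic.
  Integration by parts gives \<open>P[f] = c + \<partial>P[F]/\<partial>\<theta>\<close>, which reduces everything to continuous data: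
  \<open>P[F]\<close> is the real part of the holomorphic Herglotz integral \<open>H\<close> of \<open>F\<close>, so that
  \<open>P[f] = Re (c + \<i>z H'(z))\<close> is harmonic; and \<open>\<integral>\<^sub>a\<^sup>b (P[f]\<^sub>r - f) = (P[F]\<^sub>r - F)(b) - (P[F]\<^sub>r - F)(a)\<close>,
  so that convergence in the Alexiewicz norm is the uniform convergence \<open>P[F]\<^sub>r \<rightarrow> F\<close>.
  For uniqueness, the maximum principle yields the Poisson formula \<open>u(Rz) = P[u\<^sub>R](z)\<close> for \<open>R < 1\<close>. At a
  fixed \<open>z\<close> the Poisson integral is bounded by a multiple of the Alexiewicz norm, so letting
  \<open>R \<rightarrow> 1\<close> gives \<open>u = P[f]\<close>.
\<close>

subsection \<open>Integration by parts for Henstock--Kurzweil integrals\<close>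

text \<open>The second mean value theorem gives a point \<open>c\<close> with integral
  \<open>g x * (F c - F x) + g y * (F y - F c)\<close>. Since \<open>g'\<close> integrates to
  \<open>g y - g x\<close>, the defect in the formula for integration by parts is exactly the
  integral of \<open>(F t - F c) * g' t\<close>, hence at most the oscillation of \<open>F\<close>
  times the bound of \<open>g'\<close> times the length.\<close>

lemma by_parts_increment_bound:
  fixes f g g' :: "real \<Rightarrow> real" and a b :: real
  defines "F \<equiv> \<lambda>t. integral {a..t} f"
  assumes f: "f integrable_on {a..b}" and xy: "a \<le> x" "x \<le> y" "y \<le> b"
    and g: "\<And>t. t \<in> {a..b} \<Longrightarrow> (g has_real_derivative g' t) (at t within {a..b})"
    and g': "continuous_on {a..b} g'"
    and pos: "\<And>t. t \<in> {a..b} \<Longrightarrow> 0 \<le> g' t"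
    and M: "\<And>t. t \<in> {a..b} \<Longrightarrow> g' t \<le> M"
    and osc: "\<And>s t. \<lbrakk>s \<in> {x..y}; t \<in> {x..y}\<rbrakk> \<Longrightarrow> \<bar>F s - F t\<bar> \<le> e"
  shows "(\<lambda>t. g t * f t) integrable_on {x..y}"
    and "\<bar>integral {x..y} (\<lambda>t. g t * f t) - (F y * g y - F x * g x)
          + integral {x..y} (\<lambda>t. F t * g' t)\<bar> \<le> e * M * (y - x)"
proof -
  have sub: "{x..y} \<subseteq> {a..b}"
    using xy by auto
  have F: "continuous_on {a..b} F"
    unfolding F_def by (rule indefinite_integral_continuous_1[OF f])
  have f_sub: "f integrable_on {s..t}" if "a \<le> s" "t \<le> b" for s t
    using integrable_subinterval_real[OF f, of s t] that by auto
  have int_f: "integral {s..t} f = F t - F s" if "a \<le> s" "s \<le> t" "t \<le> b" for s t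
    using Henstock_Kurzweil_Integration.integral_combine[OF that(1,2) f_sub[of a t]] that unfolding F_def by simp
  have g_sub: "(g has_real_derivative g' t) (at t within {x..y})" if "t \<in> {x..y}" for t
    using g[of t] that sub by (meson DERIV_subset subsetD)
  have mono: "g s \<le> g t" if "x \<le> s" "s \<le> t" "t \<le> y" for s t
  proof (rule DERIV_nonneg_imp_increasing_open[OF that(2)])
    show "\<exists>d. DERIV g u :> d \<and> 0 \<le> d" if u: "s < u" "u < t" for u
    proof -
      have "u \<in> interior {a..b}" "u \<in> {a..b}"
        using u \<open>x \<le> s\<close> \<open>t \<le> y\<close> xy by auto
      then show ?thesis
        using g[of u] pos[of u] by (metis at_within_interior)
    qed
    have "continuous_on {x..y} g"
      using g_sub by (metis DERIV_continuous continuous_on_eq_continuous_within)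
    then show "continuous_on {s..t} g"
      by (rule continuous_on_subset) (use that in auto)
  qed
  obtain c where c: "c \<in> {x..y}"
    and hi: "((\<lambda>t. g t * f t) has_integral (g x * integral {x..c} f + g y * integral {c..y} f)) {x..y}"
    by (rule second_mean_value_theorem_full[where g = g, OF f_sub[OF xy(1) xy(3)] xy(2) mono])
  show "(\<lambda>t. g t * f t) integrable_on {x..y}"
    using hi by blast
  have ftc: "(g' has_integral (g y - g x)) {x..y}"
    by (rule fundamental_theorem_of_calculus[OF xy(2)])
      (use g_sub in \<open>simp add: has_real_derivative_iff_has_vector_derivative\<close>)
  have contFg: "continuous_on {x..y} (\<lambda>t. F t * g' t)"
    and contFcg: "continuous_on {x..y} (\<lambda>t. (F t - F c) * g' t)"
    using F g' sub by (auto intro!: continuous_intros intro: continuous_on_subset)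
  have "integral {x..y} (\<lambda>t. (F t - F c) * g' t)
        = integral {x..y} (\<lambda>t. F t * g' t) - F c * (g y - g x)"
    using has_integral_diff[OF integrable_integral[OF integrable_continuous_interval[OF contFg]]
        has_integral_mult_right[OF ftc, of "F c"]]
    by (auto simp: algebra_simps dest!: integral_unique)
  moreover have "integral {x..y} (\<lambda>t. g t * f t) = g x * (F c - F x) + g y * (F y - F c)"
    using integral_unique[OF hi] int_f[of x c] int_f[of c y] c xy by auto
  ultimately have "integral {x..y} (\<lambda>t. g t * f t) - (F y * g y - F x * g x)
      + integral {x..y} (\<lambda>t. F t * g' t) = integral {x..y} (\<lambda>t. (F t - F c) * g' t)"
    by (simp add: algebra_simps)
  moreover have "norm (integral {x..y} (\<lambda>t. (F t - F c) * g' t)) \<le> e * M * (y - x)"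
  proof (rule integral_bound[OF xy(2) contFcg])
    fix t assume t: "t \<in> {x..y}"
    have "\<bar>F t - F c\<bar> * \<bar>g' t\<bar> \<le> e * M"
      by (rule mult_mono) (use osc[OF t c] pos[of t] M[of t] t sub in auto)
    then show "norm ((F t - F c) * g' t) \<le> e * M"
      by (simp add: abs_mult)
  qed
  ultimately show "\<bar>integral {x..y} (\<lambda>t. g t * f t) - (F y * g y - F x * g x)
          + integral {x..y} (\<lambda>t. F t * g' t)\<bar> \<le> e * M * (y - x)"
    by simp
qed

text \<open>The defect, as a function of the right endpoint, has derivative zero: on a short
  interval the oscillation of the continuous function \<open>F\<close> is small, so the increment of
  the defect is of smaller order than the length. The defect vanishes at \<open>a\<close>, hence
  also at \<open>b\<close>.\<close>

lemma has_integral_by_parts_monotone: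
  fixes f g g' :: "real \<Rightarrow> real" and a b :: real
  defines "F \<equiv> \<lambda>t. integral {a..t} f"
  assumes f: "f integrable_on {a..b}" and ab: "a \<le> b"
    and g: "\<And>t. t \<in> {a..b} \<Longrightarrow> (g has_real_derivative g' t) (at t within {a..b})"
    and g': "continuous_on {a..b} g'"
    and pos: "\<And>t. t \<in> {a..b} \<Longrightarrow> 0 \<le> g' t"
  shows "((\<lambda>t. g t * f t) has_integral (F b * g b - integral {a..b} (\<lambda>t. F t * g' t))) {a..b}"
proof -
  have F: "continuous_on {a..b} F"
    unfolding F_def by (rule indefinite_integral_continuous_1[OF f])
  obtain M where M: "\<And>t. t \<in> {a..b} \<Longrightarrow> g' t \<le> M"
    using continuous_attains_sup[OF compact_Icc _ g'] ab by fastforce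
  have M0: "0 \<le> M"
    using M[of a] pos[of a] ab by auto
  have "bounded (F ` {a..b})"
    using F compact_Icc compact_continuous_image compact_imp_bounded by blast
  then obtain B where B: "\<And>t. t \<in> {a..b} \<Longrightarrow> \<bar>F t\<bar> \<le> B"
    unfolding bounded_iff by fastforce
  have osc: "\<bar>F s - F t\<bar> \<le> 2 * B" if "s \<in> {a..b}" "t \<in> {a..b}" for s t
    using B[OF that(1)] B[OF that(2)] by linarith
  \<comment> \<open>Only integrability is wanted here, so the crude oscillation bound
    \<open>2 * B\<close> on the whole interval suffices.\<close>
  have gf: "(\<lambda>t. g t * f t) integrable_on {a..b}"
    using by_parts_increment_bound(1)[OF f order.refl ab order.refl g g' pos M, of "2 * B"] osc
    unfolding F_def by blast
  have Fg': "(\<lambda>t. F t * g' t) integrable_on {a..b}"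
    by (intro integrable_continuous_interval continuous_intros F g')
  define H where "H = (\<lambda>t. integral {a..t} (\<lambda>t. g t * f t) - F t * g t + integral {a..t} (\<lambda>t. F t * g' t))"
  have H_diff: "H y - H x = integral {x..y} (\<lambda>t. g t * f t) - (F y * g y - F x * g x)
          + integral {x..y} (\<lambda>t. F t * g' t)" if "a \<le> x" "x \<le> y" "y \<le> b" for x y
    using Henstock_Kurzweil_Integration.integral_combine[OF that(1,2) integrable_subinterval_real[OF gf, of a y]]
      Henstock_Kurzweil_Integration.integral_combine[OF that(1,2) integrable_subinterval_real[OF Fg', of a y]] that
    unfolding H_def by auto
  have "(H has_derivative (\<lambda>h. 0)) (at x within {a..b})" if x: "x \<in> {a..b}" for x
    unfolding has_derivative_within_alt
  proof (intro conjI allI impI)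
    fix e :: real assume "e > 0"
    \<comment> \<open>The divisor is \<open>M + 1\<close> because \<open>M\<close> may be
      zero.\<close>
    define e' where "e' = e / (M + 1)"
    have e': "e' > 0" "e' * M \<le> e"
      using \<open>e > 0\<close> M0 by (auto simp: e'_def field_simps)
    have "uniformly_continuous_on {a..b} F"
      by (rule compact_uniformly_continuous[OF F compact_Icc])
    then obtain d where d: "d > 0"
      "\<And>s t. \<lbrakk>s \<in> {a..b}; t \<in> {a..b}; dist s t < d\<rbrakk> \<Longrightarrow> dist (F s) (F t) < e'"
      unfolding uniformly_continuous_on_def using e'(1) by metis
    have *: "\<bar>H v - H u\<bar> \<le> e * (v - u)" if "a \<le> u" "u \<le> v" "v \<le> b" "v - u < d" for u v
    proof -
      have "\<bar>F s - F t\<bar> \<le> e'" if "s \<in> {u..v}" "t \<in> {u..v}" for s t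
      proof -
        have "\<bar>s - t\<bar> < d"
          using that \<open>v - u < d\<close> by auto
        then show ?thesis
          using d(2)[of s t] that \<open>a \<le> u\<close> \<open>v \<le> b\<close> by (auto simp: dist_real_def)
      qed
      then have "\<bar>H v - H u\<bar> \<le> e' * M * (v - u)"
        using by_parts_increment_bound(2)[OF f that(1-3) g g' pos M, of e'] H_diff[OF that(1-3)]
        unfolding F_def by simp
      also have "\<dots> \<le> e * (v - u)"
        using e'(2) that by (intro mult_right_mono) auto
      finally show ?thesis .
    qed
    show "\<exists>d>0. \<forall>y\<in>{a..b}. norm (y - x) < d \<longrightarrow> norm (H y - H x - 0) \<le> e * norm (y - x)"
    proof (intro exI[of _ d] conjI ballI impI d(1))
      fix y assume y: "y \<in> {a..b}" "norm (y - x) < d"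
      show "norm (H y - H x - 0) \<le> e * norm (y - x)"
        using *[of x y] *[of y x] x y by (cases "x \<le> y") (auto simp: abs_minus_commute)
    qed
  qed simp
  from has_derivative_zero_unique[OF convex_real_interval(5) this, of a b] ab
  have "H b = H a" by auto
  then have "integral {a..b} (\<lambda>t. g t * f t) = F b * g b - integral {a..b} (\<lambda>t. F t * g' t)"
    unfolding H_def by (simp add: F_def)
  then show ?thesis
    using gf by (metis integrable_integral)
qed

text \<open>The integrand \<open>f\<close> is merely Henstock--Kurzweil integrable, so its indefinite integral need not have
  \<open>f\<close> as its derivative and the integration by parts of the library does not apply. Adding a linear
  function makes \<open>g\<close> increasing, as the second mean value theorem requires.\<close>

lemma has_integral_by_parts_indefinite:
  fixes f g g' :: "real \<Rightarrow> real" and a b :: real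
  defines "F \<equiv> \<lambda>t. integral {a..t} f"
  assumes f: "f integrable_on {a..b}" and ab: "a \<le> b"
    and g: "\<And>t. t \<in> {a..b} \<Longrightarrow> (g has_real_derivative g' t) (at t within {a..b})"
    and g': "continuous_on {a..b} g'"
  shows "((\<lambda>t. f t * g t) has_integral (F b * g b - integral {a..b} (\<lambda>t. F t * g' t))) {a..b}"
proof -
  have F: "continuous_on {a..b} F"
    unfolding F_def by (rule indefinite_integral_continuous_1[OF f])
  have "bounded (g' ` {a..b})"
    using g' compact_Icc compact_continuous_image compact_imp_bounded by blast
  then obtain M where M: "\<And>t. t \<in> {a..b} \<Longrightarrow> \<bar>g' t\<bar> \<le> M"
    unfolding bounded_iff by fastforce
  have M0: "0 \<le> M"
    using M[of a] ab by auto
  have 1: "((\<lambda>t. (g t + M * t) * f t) has_integral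
      (F b * (g b + M * b) - integral {a..b} (\<lambda>t. F t * (g' t + M)))) {a..b}"
    unfolding F_def
  proof (rule has_integral_by_parts_monotone[OF f ab])
    show "0 \<le> g' t + M" if "t \<in> {a..b}" for t
      using M[OF that] by linarith
  qed (auto intro!: derivative_eq_intros g continuous_intros g')
  \<comment> \<open>The added function \<open>M * t\<close> is itself increasing, so the same lemma
    evaluates its contribution, which is then subtracted from \<open>1\<close>.\<close>
  have 2: "((\<lambda>t. (M * t) * f t) has_integral
      (F b * (M * b) - integral {a..b} (\<lambda>t. F t * M))) {a..b}"
    unfolding F_def
    by (rule has_integral_by_parts_monotone[OF f ab])
      (auto intro!: derivative_eq_intros M0 continuous_intros)
  have "integral {a..b} (\<lambda>t. F t * (g' t + M))
      = integral {a..b} (\<lambda>t. F t * g' t) + integral {a..b} (\<lambda>t. F t * M)"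
    by (subst integral_add[symmetric])
      (auto simp: algebra_simps intro!: integrable_continuous_interval continuous_intros F g')
  then show ?thesis
    using has_integral_diff[OF 1 2] by (simp add: algebra_simps)
qed

subsection \<open>Primitives and the Alexiewicz norm\<close>

text \<open>Rounding \<open>y / (2 * pi)\<close> to the nearest integer leaves an error of at most
  1/2, that is, half a period.\<close>

lemma periodic_reduce:
  fixes y :: real
  obtains k :: int where "y + of_int k * (2 * pi) \<in> {-pi..pi}"
proof -
  define q where "q = y / (2 * pi)"
  have "y + of_int (- round q) * (2 * pi) = - ((of_int (round q) - q) * (2 * pi))"
    by (simp add: q_def field_simps)
  also have "\<bar>\<dots>\<bar> \<le> 1 / 2 * (2 * pi)"
    unfolding abs_minus_cancel abs_mult by (intro mult_mono of_int_round_abs_le) auto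
  finally show thesis
    by (intro that[of "- round q"]) (auto simp: abs_le_iff)
qed

lemma periodic_bounded:
  fixes g :: "real \<Rightarrow> real"
  assumes g: "continuous_on UNIV g" "\<And>x. g (x + 2 * pi) = g x"
  obtains B where "\<And>x. \<bar>g x\<bar> \<le> B"
proof -
  interpret periodic_fun_simple g "2 * pi"
    by standard (rule g(2))
  have "bounded (g ` {-pi..pi})"
    by (intro compact_imp_bounded compact_continuous_image continuous_on_subset[OF g(1)]) auto
  then obtain B where B: "\<And>x. x \<in> {-pi..pi} \<Longrightarrow> \<bar>g x\<bar> \<le> B"
    unfolding bounded_iff by fastforce
  show thesis
  proof (rule that[of B])
    fix x
    obtain k where "x + of_int k * (2 * pi) \<in> {-pi..pi}"
      by (rule periodic_reduce)
    then show "\<bar>g x\<bar> \<le> B"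
      using B plus_of_int by metis
  qed
qed

lemma HK_periodic:
  assumes "f \<in> HK"
  shows "f (x + 2 * pi) = f x" "f (x + of_int k * (2 * pi)) = f x" "f (x + real n * (2 * pi)) = f x"
proof -
  interpret periodic_fun_simple f "2 * pi"
    by standard (use assms in \<open>auto simp: HK_def\<close>)
  show "f (x + 2 * pi) = f x" "f (x + of_int k * (2 * pi)) = f x" "f (x + real n * (2 * pi)) = f x"
    using plus_1[of x] plus_of_int[of x k] plus_of_nat[of x n] by simp_all
qed

text \<open>Integrability is extended to the right one period at a time. Translating an interval of
  \<open>2 * n + 1\<close> periods back by \<open>n\<close> periods makes it symmetric about 0, and
  for large \<open>n\<close> it contains \<open>{a..b}\<close>.\<close>

lemma HK_integrable:
  assumes f: "f \<in> HK"
  shows "f integrable_on {a..b}"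
proof -
  have base: "f integrable_on {-pi..pi}"
    using f by (simp add: HK_def)
  have right: "f integrable_on {-pi..pi + real n * (2 * pi)}" for n
  proof (induction n)
    case 0
    then show ?case using base by simp
  next
    case (Suc n)
    have "(\<lambda>x. f (x + real (Suc n) * (2 * pi)))
        integrable_on {(pi + real n * (2 * pi)) - real (Suc n) * (2 * pi)
                       ..(pi + real (Suc n) * (2 * pi)) - real (Suc n) * (2 * pi)}"
      unfolding HK_periodic(3)[OF f] using base by (simp add: algebra_simps)
    then have "f integrable_on {pi + real n * (2 * pi)..pi + real (Suc n) * (2 * pi)}"
      unfolding integrable_shift_real_ivl_iff .
    then show ?case
      by (intro Henstock_Kurzweil_Integration.integrable_combine[OF _ _ Suc]) (auto simp: algebra_simps add_increasing)
  qed
  obtain n where n: "\<bar>a\<bar> \<le> real n" "\<bar>b\<bar> \<le> real n"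
    using real_arch_simple[of "max \<bar>a\<bar> \<bar>b\<bar>"] by auto
  have "(\<lambda>x. f (x + real n * (2 * pi)))
      integrable_on {-pi - real n * (2 * pi)..(pi + real (2 * n) * (2 * pi)) - real n * (2 * pi)}"
    unfolding integrable_shift_real_ivl_iff by (rule right)
  then have *: "f integrable_on {-pi - real n * (2 * pi)..(pi + real (2 * n) * (2 * pi)) - real n * (2 * pi)}"
    unfolding HK_periodic(3)[OF f] .
  have "real n \<le> real n * (2 * pi)"
    using mult_left_mono[of 1 "2 * pi" "real n"] pi_ge_two by simp
  then have "-pi - real n * (2 * pi) \<le> a" "b \<le> pi + real n * (2 * pi)"
    using n pi_gt_zero by linarith+
  then show ?thesis
    by (intro integrable_subinterval_real[OF *]) (auto simp: algebra_simps)
qed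

lemma HK_diff:
  assumes "f \<in> HK" "g \<in> HK"
  shows "(\<lambda>x. f x - g x) \<in> HK"
  using assms by (auto simp: HK_def intro: integrable_diff)

lemma HK_continuous:
  assumes "continuous_on UNIV g" "\<And>x. g (x + 2 * pi) = g x"
  shows "g \<in> HK"
  using assms by (auto simp: HK_def intro!: integrable_continuous_interval intro: continuous_on_subset)

text \<open>Subtracting the mean \<open>c\<close> makes the indefinite integral periodic.\<close>

lemma HK_periodic_primitive:
  fixes f :: "real \<Rightarrow> real"
  defines "c \<equiv> integral {-pi..pi} f / (2 * pi)"
  assumes f: "f \<in> HK"
  obtains F where "continuous_on UNIV F" "\<And>x. F (x + 2 * pi) = F x" "F (-pi) = 0"
    "\<And>a b. a \<le> b \<Longrightarrow> ((\<lambda>x. f x - c) has_integral (F b - F a)) {a..b}"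
proof -
  define h where "h = (\<lambda>x. f x - c)"
  have h: "h \<in> HK"
    unfolding h_def by (rule HK_diff[OF f]) (auto intro: HK_continuous)
  have h_int: "h integrable_on {a..b}" for a b
    by (rule HK_integrable[OF h])
  have combine: "integral {a..x} h + integral {x..b} h = integral {a..b} h" if "a \<le> x" "x \<le> b" for a b x
    by (rule Henstock_Kurzweil_Integration.integral_combine[OF that h_int])
  \<comment> \<open>This is the oriented integral from \<open>-pi\<close> to \<open>x\<close>: an
    integral over an empty or one-point interval is zero, so at most one of the two terms is
    present.\<close>
  define F where "F = (\<lambda>x. integral {-pi..x} h - integral {x..-pi} h)"
  have F_right: "F x = integral {-pi..x} h" if "-pi \<le> x" for x
    using that by (cases "x = -pi") (auto simp: F_def)
  have F_left: "F x = - integral {x..-pi} h" if "x \<le> -pi" for x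
    using that by (cases "x = -pi") (auto simp: F_def)
  have F_diff: "F b - F a = integral {a..b} h" if "a \<le> b" for a b
  proof -
    consider "-pi \<le> a" | "a \<le> -pi" "-pi \<le> b" | "b \<le> -pi"
      by linarith
    then show ?thesis
    proof cases
      case 1
      then show ?thesis
        using combine[of "-pi" a b] that by (simp add: F_right)
    next
      case 2
      then show ?thesis
        using combine[of a "-pi" b] by (simp add: F_right F_left)
    next
      case 3
      then show ?thesis
        using combine[of a b "-pi"] that by (simp add: F_left)
    qed
  qed
  have prim: "(h has_integral (F b - F a)) {a..b}" if "a \<le> b" for a b
    unfolding F_diff[OF that] by (rule integrable_integral[OF h_int])
  \<comment> \<open>Near \<open>x\<close>, \<open>F\<close> is a constant plus the indefinite
    integral of \<open>h\<close> from \<open>x - 1\<close>.\<close>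
  have "continuous (at x) F" for x
  proof -
    have *: "continuous_on {x-1..x+1} (\<lambda>t. F (x - 1) + integral {x-1..t} h)"
      by (intro continuous_intros indefinite_integral_continuous_1[OF h_int])
    have "continuous_on {x-1..x+1} F"
    proof (rule continuous_on_eq[OF *])
      fix t assume "t \<in> {x-1..x+1}"
      then show "F (x - 1) + integral {x-1..t} h = F t"
        using F_diff[of "x - 1" t] by simp
    qed
    then show ?thesis
      by (rule continuous_on_interior) auto
  qed
  then have cont: "continuous_on UNIV F"
    by (simp add: continuous_on_eq_continuous_at)
  have "((\<lambda>x. f x - c) has_integral (integral {-pi..pi} f - c * (2 * pi))) {-pi..pi}"
    using has_integral_diff[OF integrable_integral[OF HK_integrable[OF f, of "-pi" pi]]
        has_integral_const_real[of c "-pi" pi]] by (simp add: mult.commute)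
  \<comment> \<open>Here the choice of \<open>c\<close> as the mean of \<open>f\<close>
    enters.\<close>
  then have mean: "F pi - F (-pi) = 0"
    using has_integral_unique[OF prim[of "-pi" pi, unfolded h_def]] by (simp add: c_def)
  \<comment> \<open>Periodicity of \<open>h\<close> makes the increments of \<open>F\<close>
    invariant under translation by a period. Together with \<open>mean\<close>, comparison with the
    base point \<open>-pi\<close> gives periodicity of \<open>F\<close>.\<close>
  have shift: "F (b + 2 * pi) - F (a + 2 * pi) = F b - F a" if "a \<le> b" for a b
  proof -
    have "((\<lambda>x. h (x + 2 * pi)) has_integral (F (b + 2 * pi) - F (a + 2 * pi)))
        {a + 2 * pi - 2 * pi..b + 2 * pi - 2 * pi}"
      by (intro has_integral_shift_real_ivl prim) (use that in simp)
    then have "(h has_integral (F (b + 2 * pi) - F (a + 2 * pi))) {a..b}"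
      by (simp add: HK_periodic[OF h])
    then show ?thesis
      using prim[OF that] has_integral_unique by blast
  qed
  have "F (x + 2 * pi) = F x" for x
    using shift[of "-pi" x] shift[of x "-pi"] mean by (cases "x \<le> -pi") auto
  moreover have "F (-pi) = 0"
    by (simp add: F_right)
  ultimately show thesis
    using that cont prim unfolding h_def by blast
qed

text \<open>Over \<open>{a..b}\<close> the integral of \<open>f\<close> is
  \<open>c * (b - a)\<close> plus an increment of a bounded function. This makes the supremum in
  \<open>alexiewicz_norm\<close> one of a bounded set.\<close>

lemma HK_integral_bounded:
  assumes f: "f \<in> HK"
  obtains B where "\<forall>a b. a \<le> b \<and> b - a \<le> 2 * pi \<longrightarrow> \<bar>integral {a..b} f\<bar> \<le> B"
proof -
  define c where "c = integral {-pi..pi} f / (2 * pi)"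
  obtain F where F: "continuous_on UNIV F" "\<And>x. F (x + 2 * pi) = F x"
    "\<And>a b. a \<le> b \<Longrightarrow> ((\<lambda>x. f x - c) has_integral (F b - F a)) {a..b}"
    using HK_periodic_primitive[OF f] unfolding c_def by metis
  obtain M where M: "\<And>x. \<bar>F x\<bar> \<le> M"
    using periodic_bounded[OF F(1,2)] by auto
  show thesis
  proof (rule that[of "\<bar>c\<bar> * (2 * pi) + 2 * M"], intro allI impI, elim conjE)
    fix a b :: real assume ab: "a \<le> b" "b - a \<le> 2 * pi"
    have "integral {a..b} f = c * (b - a) + (F b - F a)"
      using has_integral_add[OF F(3)[OF ab(1)] has_integral_const_real[of c a b]] ab
      by (auto simp: algebra_simps dest!: integral_unique)
    moreover have "\<bar>c * (b - a)\<bar> \<le> \<bar>c\<bar> * (2 * pi)"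
      using ab by (auto simp: abs_mult intro!: mult_mono)
    ultimately show "\<bar>integral {a..b} f\<bar> \<le> \<bar>c\<bar> * (2 * pi) + 2 * M"
      using M[of a] M[of b] by linarith
  qed
qed

lemma abs_integral_le_alexiewicz_norm:
  assumes f: "f \<in> HK" and "a \<le> b" "b - a \<le> 2 * pi"
  shows "\<bar>integral {a..b} f\<bar> \<le> alexiewicz_norm f"
proof -
  obtain B where "\<forall>a b. a \<le> b \<and> b - a \<le> 2 * pi \<longrightarrow> \<bar>integral {a..b} f\<bar> \<le> B"
    by (rule HK_integral_bounded[OF f])
  then have "bdd_above ((\<lambda>(a, b). \<bar>integral {a..b} f\<bar>) ` {(a, b). a \<le> b \<and> b - a \<le> 2 * pi})"
    by (intro bdd_aboveI[of _ B]) auto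
  then show ?thesis
    unfolding alexiewicz_norm_def
    using cSUP_upper[of "(a, b)" "{(a, b). a \<le> b \<and> b - a \<le> 2 * pi}" "\<lambda>(a, b). \<bar>integral {a..b} f\<bar>"] assms(2,3)
    by simp
qed

text \<open>Bounding the absolute value lets convergence of the norm to 0 be read off directly, with
  no separate argument for its sign.\<close>

lemma abs_alexiewicz_norm_le:
  assumes "\<And>a b. \<lbrakk>a \<le> b; b - a \<le> 2 * pi\<rbrakk> \<Longrightarrow> \<bar>integral {a..b} f\<bar> \<le> B"
  shows "\<bar>alexiewicz_norm f\<bar> \<le> B"
  unfolding alexiewicz_norm_def
proof (rule cSup_abs_le)
  show "(\<lambda>(a, b). \<bar>integral {a..b} f\<bar>) ` {(a, b). a \<le> b \<and> b - a \<le> 2 * pi} \<noteq> {}"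
    by (auto intro!: exI[of _ "0::real"])
qed (use assms in auto)

subsection \<open>The Herglotz integral\<close>

text \<open>The kernel is holomorphic in \<open>z\<close>, and its real part is
  \<open>2 * pi\<close> times the Poisson kernel. So for continuous \<open>g\<close> this is a
  holomorphic function on the disc whose real part is the Poisson integral of
  \<open>g\<close>.\<close>

definition herglotz :: "(real \<Rightarrow> real) \<Rightarrow> complex \<Rightarrow> complex" where
  "herglotz g z = integral {-pi..pi} (\<lambda>\<phi>. of_real (g \<phi>) * ((cis \<phi> + z) / (cis \<phi> - z))) / of_real (2 * pi)"

lemma cis_diff_nonzero:
  assumes "z \<in> ball 0 1"
  shows "cis \<phi> - z \<noteq> 0"
  using assms by (metis cis_conv_exp eq_iff_diff_eq_0 less_irrefl mem_ball_0 norm_cis)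

text \<open>The second integrand is the derivative of the first with respect to
  \<open>z\<close>.\<close>

lemma continuous_on_herglotz_integrands:
  assumes g: "continuous_on {-pi..pi} g" and z: "z \<in> ball 0 1"
  shows "continuous_on {-pi..pi} (\<lambda>\<phi>. of_real (g \<phi>) * ((cis \<phi> + z) / (cis \<phi> - z)))"
    and "continuous_on {-pi..pi} (\<lambda>\<phi>. of_real (g \<phi>) * (2 * cis \<phi> / (cis \<phi> - z)\<^sup>2))"
  by (intro continuous_intros g; use cis_diff_nonzero[OF z] in simp)+

lemma has_field_derivative_herglotz:
  assumes g: "continuous_on {-pi..pi} g" and z: "z \<in> ball 0 1"
  shows "(herglotz g has_field_derivative
      integral {-pi..pi} (\<lambda>\<phi>. of_real (g \<phi>) * (2 * cis \<phi> / (cis \<phi> - z)\<^sup>2)) / of_real (2 * pi)) (at z)"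
proof -
  have "((\<lambda>z. integral (cbox (-pi) pi) (\<lambda>\<phi>. of_real (g \<phi>) * ((cis \<phi> + z) / (cis \<phi> - z)))) has_field_derivative
      integral (cbox (-pi) pi) (\<lambda>\<phi>. of_real (g \<phi>) * (2 * cis \<phi> / (cis \<phi> - z)\<^sup>2))) (at z within ball 0 1)"
  proof (rule leibniz_rule_field_derivative[OF _ _ _ z convex_ball])
    fix w :: complex and t :: real assume w: "w \<in> ball 0 1"
    note nz = cis_diff_nonzero[OF w]
    show "((\<lambda>w. of_real (g t) * ((cis t + w) / (cis t - w))) has_field_derivative
        of_real (g t) * (2 * cis t / (cis t - w)\<^sup>2)) (at w within ball 0 1)"
      using nz[of t] by (auto intro!: derivative_eq_intros simp: power2_eq_square algebra_simps)
    show "(\<lambda>\<phi>. of_real (g \<phi>) * ((cis \<phi> + w) / (cis \<phi> - w))) integrable_on cbox (-pi) pi"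
      using integrable_continuous_interval[OF continuous_on_herglotz_integrands(1)[OF g w]] by simp
  next
    show "continuous_on (ball 0 1 \<times> cbox (-pi) pi)
        (\<lambda>(z, \<phi>). of_real (g \<phi>) * (2 * cis \<phi> / (cis \<phi> - z)\<^sup>2))"
      unfolding split_beta
    proof (intro continuous_intros ballI)
      show "continuous_on (ball 0 1 \<times> cbox (-pi) pi) (\<lambda>p. g (snd p))"
        by (rule continuous_on_compose2[OF g]) (auto intro!: continuous_intros)
      show "(cis (snd p) - fst p)\<^sup>2 \<noteq> 0" if "p \<in> ball 0 1 \<times> cbox (-pi) pi" for p
        using that cis_diff_nonzero[of "fst p"] by auto
    qed
  qed
  then show ?thesis
    using z unfolding herglotz_def by (auto simp: at_within_open[OF z] intro: DERIV_cdivide)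
qed

lemma deriv_herglotz:
  assumes "continuous_on {-pi..pi} g" "z \<in> ball 0 1"
  shows "deriv (herglotz g) z
    = integral {-pi..pi} (\<lambda>\<phi>. of_real (g \<phi>) * (2 * cis \<phi> / (cis \<phi> - z)\<^sup>2)) / of_real (2 * pi)"
  by (rule DERIV_imp_deriv[OF has_field_derivative_herglotz[OF assms]])

lemma holomorphic_herglotz:
  assumes "continuous_on {-pi..pi} g"
  shows "herglotz g holomorphic_on ball 0 1"
  unfolding holomorphic_on_open[OF open_ball] using has_field_derivative_herglotz[OF assms] by blast

text \<open>The kernel depends on \<open>z\<close> and \<open>\<phi>\<close> only through
  \<open>z * cis (- \<phi>)\<close>, so differentiation in \<open>\<phi>\<close> acts as
  \<open>- \<i> * z\<close> times differentiation in \<open>z\<close>.\<close>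

lemma has_vector_derivative_herglotz_kernel:
  assumes z: "z \<in> ball 0 1"
  shows "((\<lambda>\<phi>. (cis \<phi> + z) / (cis \<phi> - z)) has_vector_derivative - (\<i> * z * (2 * cis \<phi> / (cis \<phi> - z)\<^sup>2)))
    (at \<phi> within A)"
proof -
  have cis: "(cis has_vector_derivative (\<i> * cis \<phi>)) (at \<phi> within A)"
    unfolding has_vector_derivative_def by (auto intro!: derivative_eq_intros)
  have "((\<lambda>w. (w + z) / (w - z)) has_field_derivative (- (2 * z) / (cis \<phi> - z)\<^sup>2)) (at (cis \<phi>) within cis ` A)"
    using cis_diff_nonzero[OF z, of \<phi>] by (auto intro!: derivative_eq_intros simp: power2_eq_square)
  from field_vector_diff_chain_within[OF cis this] show ?thesis
    by (simp add: o_def algebra_simps)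
qed

text \<open>The integrand of the derivative has the periodic primitive
  \<open>2 * \<i> / (cis \<phi> - z)\<close>, so the derivative vanishes on the disc and the
  function keeps its value at 0.\<close>

lemma herglotz_one:
  assumes z: "z \<in> ball 0 1"
  shows "herglotz (\<lambda>_. 1) z = 1"
proof -
  have "(herglotz (\<lambda>_. 1) has_derivative (\<lambda>h. 0)) (at z within ball 0 1)" if z: "z \<in> ball 0 1" for z
  proof -
    have "((\<lambda>\<phi>. 2 * cis \<phi> / (cis \<phi> - z)\<^sup>2) has_integral
        (2 * \<i> / (cis pi - z) - 2 * \<i> / (cis (-pi) - z))) {-pi..pi}"
    proof (rule fundamental_theorem_of_calculus)
      fix \<phi> :: real
      have cis: "(cis has_vector_derivative (\<i> * cis \<phi>)) (at \<phi> within {-pi..pi})"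
        unfolding has_vector_derivative_def by (auto intro!: derivative_eq_intros)
      have "((\<lambda>w. 2 * \<i> / (w - z)) has_field_derivative (- (2 * \<i>) / (cis \<phi> - z)\<^sup>2))
          (at (cis \<phi>) within cis ` {-pi..pi})"
        using cis_diff_nonzero[OF z, of \<phi>] by (auto intro!: derivative_eq_intros simp: power2_eq_square)
      from field_vector_diff_chain_within[OF cis this]
      show "((\<lambda>\<phi>. 2 * \<i> / (cis \<phi> - z)) has_vector_derivative 2 * cis \<phi> / (cis \<phi> - z)\<^sup>2)
          (at \<phi> within {-pi..pi})"
        by (simp add: o_def algebra_simps)
    qed simp
    moreover have cis_eq: "cis (-pi) = cis pi"
      by (simp add: complex_eq_iff)
    ultimately have "integral {-pi..pi} (\<lambda>\<phi>. 2 * cis \<phi> / (cis \<phi> - z)\<^sup>2) = 0"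
      using cis_eq by (simp add: integral_unique)
    then show ?thesis
      using has_field_derivative_herglotz[OF continuous_on_const[of _ 1] z]
      by (simp add: has_field_derivative_def has_derivative_at_withinI lambda_zero)
  qed
  from has_derivative_zero_unique[OF convex_ball this z, of 0]
  have "herglotz (\<lambda>_. 1) z = herglotz (\<lambda>_. 1) 0" by simp
  also have "\<dots> = 1"
    by (simp add: herglotz_def scaleR_conv_of_real)
  finally show ?thesis .
qed

text \<open>Expanding the quotient with the conjugate of its denominator leaves
  \<open>1 - r\<^sup>2\<close> over the squared distance from \<open>cis \<phi>\<close> to
  \<open>rcis r t\<close>. Where that distance is 0, both sides are 0 by the convention for
  division.\<close>

lemma poisson_kernel_eq_Re:
  "poisson_kernel r (\<phi> - t) = Re ((cis \<phi> + rcis r t) / (cis \<phi> - rcis r t)) / (2 * pi)"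
proof -
  define z where "z = rcis r t"
  have parts: "Re (cis \<phi> - z) = cos \<phi> - r * cos t" "Im (cis \<phi> - z) = sin \<phi> - r * sin t"
    "Re (cis \<phi> + z) = cos \<phi> + r * cos t" "Im (cis \<phi> + z) = sin \<phi> + r * sin t"
    by (simp_all add: z_def)
  have "(Re (cis \<phi> - z))\<^sup>2 + (Im (cis \<phi> - z))\<^sup>2
      = ((cos \<phi>)\<^sup>2 + (sin \<phi>)\<^sup>2) - 2 * r * (cos \<phi> * cos t + sin \<phi> * sin t) + r\<^sup>2 * ((cos t)\<^sup>2 + (sin t)\<^sup>2)"
    unfolding parts by algebra
  then have den: "(Re (cis \<phi> - z))\<^sup>2 + (Im (cis \<phi> - z))\<^sup>2 = 1 - 2 * r * cos (\<phi> - t) + r\<^sup>2"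
    by (simp add: cos_diff)
  have "Re (cis \<phi> + z) * Re (cis \<phi> - z) + Im (cis \<phi> + z) * Im (cis \<phi> - z)
      = ((cos \<phi>)\<^sup>2 + (sin \<phi>)\<^sup>2) - r\<^sup>2 * ((cos t)\<^sup>2 + (sin t)\<^sup>2)"
    unfolding parts by algebra
  then have num: "Re (cis \<phi> + z) * Re (cis \<phi> - z) + Im (cis \<phi> + z) * Im (cis \<phi> - z) = 1 - r\<^sup>2"
    by simp
  show ?thesis
    unfolding z_def[symmetric] Re_divide den num poisson_kernel_def by simp
qed

lemma has_integral_poisson_continuous:
  assumes g: "continuous_on {-pi..pi} g" and z: "rcis r t \<in> ball 0 1"
  shows "((\<lambda>\<phi>. g \<phi> * poisson_kernel r (\<phi> - t)) has_integral Re (herglotz g (rcis r t))) {-pi..pi}"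
proof -
  have "((\<lambda>\<phi>. of_real (g \<phi>) * ((cis \<phi> + rcis r t) / (cis \<phi> - rcis r t)) / of_real (2 * pi)) has_integral herglotz g (rcis r t)) {-pi..pi}"
    unfolding herglotz_def
    by (intro has_integral_divide integrable_integral integrable_continuous_interval
        continuous_on_herglotz_integrands[OF g z])
  from has_integral_linear[OF this bounded_linear_Re]
  show ?thesis
    unfolding poisson_kernel_eq_Re
  proof (rule has_integral_eq[rotated])
    fix \<phi>
    have "of_real (g \<phi>) * ((cis \<phi> + rcis r t) / (cis \<phi> - rcis r t)) / of_real (2 * pi)
        = of_real (g \<phi> / (2 * pi)) * ((cis \<phi> + rcis r t) / (cis \<phi> - rcis r t))"
      by simp
    then show "(Re \<circ> (\<lambda>\<phi>. of_real (g \<phi>) * ((cis \<phi> + rcis r t) / (cis \<phi> - rcis r t)) / of_real (2 * pi))) \<phi>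
        = g \<phi> * (Re ((cis \<phi> + rcis r t) / (cis \<phi> - rcis r t)) / (2 * pi))"
      unfolding o_def by (simp only: scaleR_conv_of_real[symmetric] scaleR_complex.sel) simp
  qed
qed

text \<open>On holomorphic functions \<open>\<partial>/\<partial>\<theta>\<close> acts as \<open>\<i>z d/dz\<close>.\<close>

lemma has_integral_poisson_HK:
  assumes f: "f \<in> HK" and c: "c = integral {-pi..pi} f / (2 * pi)"
    and F: "continuous_on UNIV F" "\<And>x. F (x + 2 * pi) = F x" "F (-pi) = 0"
    and prim: "\<And>a b. a \<le> b \<Longrightarrow> ((\<lambda>x. f x - c) has_integral (F b - F a)) {a..b}"
    and z: "z \<in> ball 0 1"
  shows "((\<lambda>\<phi>. f \<phi> * poisson_kernel (cmod z) (\<phi> - Arg z)) has_integral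
           (c + Re (\<i> * z * deriv (herglotz F) z))) {-pi..pi}"
proof -
  define K where "K = (\<lambda>\<phi>. Re ((cis \<phi> + z) / (cis \<phi> - z)) / (2 * pi))"
  define K' where "K' = (\<lambda>\<phi>. Re (- (\<i> * z * (2 * cis \<phi> / (cis \<phi> - z)\<^sup>2))) / (2 * pi))"
  have F': "continuous_on {-pi..pi} F"
    using F(1) continuous_on_subset by blast
  have F_eq: "integral {-pi..t} (\<lambda>x. f x - c) = F t" if "t \<in> {-pi..pi}" for t
    using prim[of "-pi" t] that F(3) by (simp add: integral_unique)
  have "F pi = 0"
    using F(2)[of "-pi"] F(3) by simp
  \<comment> \<open>Integration by parts moves the derivative onto the smooth kernel
    \<open>K\<close>. The boundary term will vanish because \<open>F pi = 0\<close>.\<close>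
  have "((\<lambda>t. (f t - c) * K t) has_integral
      (integral {-pi..pi} (\<lambda>x. f x - c) * K pi
        - integral {-pi..pi} (\<lambda>t. integral {-pi..t} (\<lambda>x. f x - c) * K' t))) {-pi..pi}"
  proof (rule has_integral_by_parts_indefinite)
    show "(\<lambda>x. f x - c) integrable_on {-pi..pi}"
      using prim[of "-pi" pi] by auto
    show "(K has_real_derivative K' t) (at t within {-pi..pi})" for t
      unfolding K_def K'_def
      by (intro DERIV_cdivide has_field_derivative_Re has_vector_derivative_herglotz_kernel z)
    show "continuous_on {-pi..pi} K'"
      unfolding K'_def by (intro continuous_intros; use cis_diff_nonzero[OF z] in simp)
  qed simp
  also have "integral {-pi..pi} (\<lambda>t. integral {-pi..t} (\<lambda>x. f x - c) * K' t) = integral {-pi..pi} (\<lambda>t. F t * K' t)"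
    by (rule integral_cong) (simp add: F_eq)
  also have "\<dots> = - Re (\<i> * z * deriv (herglotz F) z)"
  proof -
    have "((\<lambda>\<phi>. - (\<i> * z * (of_real (F \<phi>) * (2 * cis \<phi> / (cis \<phi> - z)\<^sup>2) / of_real (2 * pi))))
        has_integral - (\<i> * z * deriv (herglotz F) z)) {-pi..pi}"
      unfolding deriv_herglotz[OF F' z]
      by (intro has_integral_neg has_integral_mult_right has_integral_divide integrable_integral
          integrable_continuous_interval continuous_on_herglotz_integrands[OF F' z])
    from has_integral_linear[OF this bounded_linear_Re]
    have "((\<lambda>\<phi>. F \<phi> * K' \<phi>) has_integral Re (- (\<i> * z * deriv (herglotz F) z))) {-pi..pi}"
    proof (rule has_integral_eq[rotated])
      fix \<phi>
      have "- (\<i> * z * (of_real (F \<phi>) * (2 * cis \<phi> / (cis \<phi> - z)\<^sup>2) / of_real (2 * pi)))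
          = of_real (F \<phi> / (2 * pi)) * (- (\<i> * z * (2 * cis \<phi> / (cis \<phi> - z)\<^sup>2)))"
        by (simp add: ac_simps)
      then show "(Re \<circ> (\<lambda>\<phi>. - (\<i> * z * (of_real (F \<phi>) * (2 * cis \<phi> / (cis \<phi> - z)\<^sup>2) / of_real (2 * pi))))) \<phi> = F \<phi> * K' \<phi>"
        unfolding o_def K'_def by (simp only: scaleR_conv_of_real[symmetric] scaleR_complex.sel) simp
    qed
    then show ?thesis
      by (simp add: integral_unique)
  qed
  finally have 1: "((\<lambda>t. (f t - c) * K t) has_integral Re (\<i> * z * deriv (herglotz F) z)) {-pi..pi}"
    by (simp add: F_eq \<open>F pi = 0\<close> algebra_simps)
  \<comment> \<open>The kernel has mass 1, so adding back the constant \<open>c\<close> contributes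
    exactly \<open>c\<close>.\<close>
  have "((\<lambda>t. 1 * K t) has_integral 1) {-pi..pi}"
    using has_integral_poisson_continuous[OF continuous_on_const[of _ 1], of "cmod z" "Arg z"] z
    by (simp add: K_def poisson_kernel_eq_Re herglotz_one[OF z] rcis_cmod_Arg)
  from has_integral_add[OF 1 has_integral_mult_right[OF this, of c]]
  have "((\<lambda>t. f t * K t) has_integral (Re (\<i> * z * deriv (herglotz F) z) + c * 1)) {-pi..pi}"
    by (rule has_integral_eq[rotated]) (simp add: left_diff_distrib)
  then show ?thesis
    by (simp add: K_def poisson_kernel_eq_Re rcis_cmod_Arg algebra_simps)
qed

subsection \<open>Estimates for the Poisson integral\<close>

lemma poisson_integral_eq_herglotz:
  assumes "continuous_on {-pi..pi} g" "z \<in> ball 0 1"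
  shows "poisson_integral g z = Re (herglotz g z)"
  unfolding poisson_integral_def
  using has_integral_poisson_continuous[OF assms(1), of "cmod z" "Arg z"] assms(2)
  by (simp add: rcis_cmod_Arg integral_unique)

text \<open>A product of a Henstock--Kurzweil integrable function with a continuous one can fail to
  be integrable; here integration by parts against the smooth kernel yields integrability.\<close>

lemma integrable_poisson:
  assumes f: "f \<in> HK" and z: "z \<in> ball 0 1"
  shows "(\<lambda>\<phi>. f \<phi> * poisson_kernel (cmod z) (\<phi> - Arg z)) integrable_on {-pi..pi}"
proof -
  obtain F where "continuous_on UNIV F" "\<And>x. F (x + 2 * pi) = F x" "F (-pi) = 0"
    "\<And>a b. a \<le> b \<Longrightarrow> ((\<lambda>x. f x - integral {-pi..pi} f / (2 * pi)) has_integral (F b - F a)) {a..b}"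
    using HK_periodic_primitive[OF f] by blast
  from has_integral_poisson_HK[OF f refl this z] show ?thesis
    by (rule has_integral_integrable)
qed

lemma poisson_integral_diff:
  assumes "f \<in> HK" "g \<in> HK" "z \<in> ball 0 1"
  shows "poisson_integral (\<lambda>x. f x - g x) z = poisson_integral f z - poisson_integral g z"
  unfolding poisson_integral_def left_diff_distrib
  by (intro Henstock_Kurzweil_Integration.integral_diff integrable_poisson assms)

text \<open>For fixed \<open>z\<close> this makes the Poisson integral continuous in the Alexiewicz
  norm. In \<open>c + Re (\<i> * z * deriv (herglotz F) z)\<close> the mean and the primitive
  \<open>F\<close> are controlled by the norm, and the differentiated kernel by the distance
  \<open>1 - cmod z\<close> to the circle.\<close>

lemma abs_poisson_integral_le:
  assumes f: "f \<in> HK" and z: "z \<in> ball 0 1"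
  shows "\<bar>poisson_integral f z\<bar> \<le> (1 + 4 / (1 - cmod z)\<^sup>2) * alexiewicz_norm f"
proof -
  define c N where "c = integral {-pi..pi} f / (2 * pi)" and "N = alexiewicz_norm f"
  obtain F where F: "continuous_on UNIV F" "\<And>x. F (x + 2 * pi) = F x" "F (-pi) = 0"
    and prim: "\<And>a b. a \<le> b \<Longrightarrow> ((\<lambda>x. f x - c) has_integral (F b - F a)) {a..b}"
    using HK_periodic_primitive[OF f] unfolding c_def by blast
  have F': "continuous_on {-pi..pi} F"
    using F(1) continuous_on_subset by blast
  have N: "\<bar>integral {-pi..x} f\<bar> \<le> N" if "x \<in> {-pi..pi}" for x
    unfolding N_def by (rule abs_integral_le_alexiewicz_norm[OF f]) (use that in auto)
  have N0: "0 \<le> N"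
    using N[of pi] by simp
  have c_N: "\<bar>c\<bar> * (2 * pi) \<le> N"
    using N[of pi] by (simp add: c_def)
  \<comment> \<open>\<open>F x\<close> is the integral of \<open>f\<close> over
    \<open>{-pi..x}\<close> minus \<open>c * (x + pi)\<close>, and each of the two is at most
    \<open>N\<close> in absolute value.\<close>
  have F_N: "\<bar>F x\<bar> \<le> 2 * N" if x: "x \<in> {-pi..pi}" for x
  proof -
    have "integral {-pi..x} f = F x + c * (x + pi)"
      using has_integral_add[OF prim[of "-pi" x] has_integral_const_real[of c "-pi" x]] x F(3)
      by (auto simp: algebra_simps dest!: integral_unique)
    moreover have "\<bar>c * (x + pi)\<bar> \<le> \<bar>c\<bar> * (2 * pi)"
      unfolding abs_mult using x by (intro mult_left_mono) auto
    ultimately show ?thesis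
      using N[OF x] c_N by linarith
  qed
  define d where "d = 1 - cmod z"
  have d: "0 < d"
    using z by (simp add: d_def)
  have "norm (integral {-pi..pi} (\<lambda>\<phi>. of_real (F \<phi>) * (2 * cis \<phi> / (cis \<phi> - z)\<^sup>2))) \<le> (2 * N * (2 / d\<^sup>2)) * (pi - (-pi))"
  proof (rule integral_bound[OF _ continuous_on_herglotz_integrands(2)[OF F' z]])
    fix \<phi> assume \<phi>: "\<phi> \<in> {-pi..pi}"
    have "d \<le> cmod (cis \<phi> - z)"
      using norm_triangle_ineq2[of "cis \<phi>" z] by (simp add: d_def)
    then have "2 / (cmod (cis \<phi> - z))\<^sup>2 \<le> 2 / d\<^sup>2"
      using d by (intro divide_left_mono power_mono mult_pos_pos) auto
    then show "norm (complex_of_real (F \<phi>) * (2 * cis \<phi> / (cis \<phi> - z)\<^sup>2)) \<le> 2 * N * (2 / d\<^sup>2)"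
      unfolding norm_mult norm_divide norm_power norm_cis norm_of_real
      using F_N[OF \<phi>] N0 by (intro mult_mono) auto
  qed simp
  then have deriv_le: "cmod (deriv (herglotz F) z) \<le> 4 / d\<^sup>2 * N"
    unfolding deriv_herglotz[OF F' z] by (simp add: norm_divide field_simps)
  have "\<bar>Re (\<i> * z * deriv (herglotz F) z)\<bar> \<le> cmod z * cmod (deriv (herglotz F) z)"
    using abs_Re_le_cmod[of "\<i> * z * deriv (herglotz F) z"] by (simp add: norm_mult)
  also have "\<dots> \<le> 1 * (4 / d\<^sup>2 * N)"
    by (intro mult_mono deriv_le) (use z in auto)
  finally have 1: "\<bar>Re (\<i> * z * deriv (herglotz F) z)\<bar> \<le> 4 / d\<^sup>2 * N"
    by simp
  have "\<bar>c\<bar> * 1 \<le> \<bar>c\<bar> * (2 * pi)"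
    using pi_ge_two by (intro mult_left_mono) auto
  then have 2: "\<bar>c\<bar> \<le> N"
    using c_N by simp
  have "poisson_integral f z = c + Re (\<i> * z * deriv (herglotz F) z)"
    unfolding poisson_integral_def
    by (rule integral_unique[OF has_integral_poisson_HK[OF f c_def F prim z]])
  then show ?thesis
    using 1 2 unfolding N_def[symmetric] d_def[symmetric] distrib_right by linarith
qed

section \<open>The Poisson kernel as an approximate identity\<close>

lemma poisson_kernel_nonneg:
  assumes "0 \<le> r" "r < 1"
  shows "0 \<le> poisson_kernel r x" "1 - 2 * r * cos x + r\<^sup>2 > 0"
proof -
  have "r * cos x \<le> r * 1"
    using assms by (intro mult_left_mono) auto
  then have "(1 - r)\<^sup>2 \<le> 1 - 2 * r * cos x + r\<^sup>2"
    by (simp add: power2_eq_square algebra_simps)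
  moreover have "(1 - r)\<^sup>2 > 0"
    using assms by simp
  ultimately show pos: "1 - 2 * r * cos x + r\<^sup>2 > 0"
    by linarith
  have "r\<^sup>2 \<le> 1"
    using assms by (simp add: power_le_one)
  then show "0 \<le> poisson_kernel r x"
    unfolding poisson_kernel_def using pos by (intro divide_nonneg_nonneg mult_nonneg_nonneg) auto
qed

text \<open>The kernel times its denominator \<open>1 - 2 * r * cos x + r\<^sup>2\<close> is
  constant. Integrating this identity and using mass 1 gives
  \<open>(1 + r\<^sup>2) - 2 * r * J = 1 - r\<^sup>2\<close> for the cosine moment \<open>J\<close>,
  hence \<open>J = r\<close>.\<close>

lemma has_integral_poisson_kernel:
  assumes r: "0 < r" "r < 1"
  shows "((\<lambda>\<phi>. poisson_kernel r (\<phi> - \<theta>)) has_integral 1) {-pi..pi}"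
    and "((\<lambda>\<phi>. (1 - cos (\<phi> - \<theta>)) * poisson_kernel r (\<phi> - \<theta>)) has_integral (1 - r)) {-pi..pi}"
proof -
  have z: "rcis r \<theta> \<in> ball 0 1"
    using r by simp
  show one: "((\<lambda>\<phi>. poisson_kernel r (\<phi> - \<theta>)) has_integral 1) {-pi..pi}"
    using has_integral_poisson_continuous[OF continuous_on_const[of _ 1] z] herglotz_one[OF z] by simp
  define J where "J = Re (herglotz (\<lambda>\<phi>. cos (\<phi> - \<theta>)) (rcis r \<theta>))"
  have J: "((\<lambda>\<phi>. cos (\<phi> - \<theta>) * poisson_kernel r (\<phi> - \<theta>)) has_integral J) {-pi..pi}"
    unfolding J_def by (rule has_integral_poisson_continuous[OF _ z]) (intro continuous_intros)
  have eq: "(1 + r\<^sup>2) * poisson_kernel r x - 2 * r * (cos x * poisson_kernel r x) = (1 - r\<^sup>2) / (2 * pi)" for x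
  proof -
    have "(1 + r\<^sup>2) * poisson_kernel r x - 2 * r * (cos x * poisson_kernel r x)
        = (1 - 2 * r * cos x + r\<^sup>2) * poisson_kernel r x"
      by (simp add: algebra_simps)
    then show ?thesis
      using poisson_kernel_nonneg(2)[of r x] r by (simp add: poisson_kernel_def)
  qed
  have "((\<lambda>\<phi>. (1 - r\<^sup>2) / (2 * pi)) has_integral ((1 + r\<^sup>2) * 1 - 2 * r * J)) {-pi..pi}"
    using has_integral_diff[OF has_integral_mult_right[OF one, of "1 + r\<^sup>2"] has_integral_mult_right[OF J, of "2 * r"]]
    unfolding eq .
  moreover have "((\<lambda>\<phi>. (1 - r\<^sup>2) / (2 * pi)) has_integral (1 - r\<^sup>2)) {-pi..pi}"
    using has_integral_const_real[of "(1 - r\<^sup>2) / (2 * pi)" "-pi" pi] by simp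
  ultimately have "(1 + r\<^sup>2) * 1 - 2 * r * J = 1 - r\<^sup>2"
    by (rule has_integral_unique)
  then have "J = r"
    using r by (simp add: power2_eq_square)
  then show "((\<lambda>\<phi>. (1 - cos (\<phi> - \<theta>)) * poisson_kernel r (\<phi> - \<theta>)) has_integral (1 - r)) {-pi..pi}"
    using has_integral_diff[OF one J] by (simp add: algebra_simps)
qed

text \<open>The weight \<open>1 - cos\<close> is chosen because its integral against the Poisson kernel is exactly \<open>1 - r\<close>.\<close>

lemma periodic_modulus:
  fixes g :: "real \<Rightarrow> real"
  assumes g: "continuous_on UNIV g" "\<And>x. g (x + 2 * pi) = g x" and e: "0 < e"
  obtains M where "0 \<le> M" "\<And>x y. \<bar>g x - g y\<bar> \<le> e + M * (1 - cos (x - y))"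
proof -
  interpret periodic_fun_simple g "2 * pi"
    by standard (rule g(2))
  interpret cos: periodic_fun_simple "cos :: real \<Rightarrow> real" "2 * pi"
    by standard simp
  obtain B where B: "\<And>x. \<bar>g x\<bar> \<le> B"
    using periodic_bounded[OF g] by blast
  have "uniformly_continuous_on {-2*pi..2*pi} g"
    by (rule compact_uniformly_continuous[OF continuous_on_subset[OF g(1)]]) auto
  then obtain d where d: "d > 0"
    "\<And>s t. \<lbrakk>s \<in> {-2*pi..2*pi}; t \<in> {-2*pi..2*pi}; dist s t < d\<rbrakk> \<Longrightarrow> dist (g s) (g t) < e"
    unfolding uniformly_continuous_on_def using e by metis
  \<comment> \<open>The cap at \<open>pi\<close> keeps \<open>d'\<close> in the range where the
    cosine decreases.\<close>
  define d' where "d' = min d pi"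
  have d': "0 < d'" "d' \<le> pi" "d' \<le> d"
    using d(1) by (auto simp: d'_def)
  have cos_d': "cos d' < 1"
    using cos_monotone_0_pi[of 0 d'] d' by simp
  \<comment> \<open>At distance at least \<open>d'\<close> the weight is at least
    \<open>1 - cos d'\<close>, so the weighted term alone reaches \<open>2 * B\<close> and dominates
    any difference of values of \<open>g\<close>.\<close>
  define M where "M = 2 * B / (1 - cos d')"
  have M0: "0 \<le> M"
    using B[of 0] cos_d' by (auto simp: M_def)
  show thesis
  proof (rule that[OF M0])
    fix x y :: real
    obtain k where k: "y + of_int k * (2 * pi) \<in> {-pi..pi}"
      by (rule periodic_reduce)
    obtain l where l: "(x - y) + of_int l * (2 * pi) \<in> {-pi..pi}"
      by (rule periodic_reduce)
    \<comment> \<open>Translates of \<open>y\<close> and \<open>x\<close> with \<open>v\<close> in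
      the base period and \<open>u\<close> within \<open>pi\<close> of it; both lie in
      \<open>{-2*pi..2*pi}\<close>, where \<open>g\<close> is uniformly continuous.\<close>
    define v u where "v = y + of_int k * (2 * pi)" and "u = v + ((x - y) + of_int l * (2 * pi))"
    have u_eq: "u = x + of_int (k + l) * (2 * pi)"
      by (simp add: u_def v_def algebra_simps)
    have gx: "g x = g u" and gy: "g y = g v"
      unfolding u_eq v_def plus_of_int by simp_all
    have "cos (u - v) = cos ((x - y) + of_int l * (2 * pi))"
      by (simp add: u_def)
    also have "\<dots> = cos (x - y)"
      by (rule cos.plus_of_int)
    finally have cos_eq: "cos (x - y) = cos (u - v)" ..
    have uv: "v \<in> {-2*pi..2*pi}" "u \<in> {-2*pi..2*pi}" "\<bar>u - v\<bar> \<le> pi"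
      using k l by (auto simp: u_def v_def[symmetric])
    show "\<bar>g x - g y\<bar> \<le> e + M * (1 - cos (x - y))"
    proof (cases "\<bar>u - v\<bar> < d'")
      case True
      then have "\<bar>g u - g v\<bar> < e"
        using d(2)[OF uv(2,1)] d'(3) by (simp add: dist_real_def)
      moreover have "0 \<le> M * (1 - cos (x - y))"
        using M0 by simp
      ultimately show ?thesis
        by (simp add: gx gy)
    next
      case False
      then have "cos \<bar>u - v\<bar> \<le> cos d'"
        using d' uv(3) by (intro cos_monotone_0_pi_le) auto
      then have "M * (1 - cos d') \<le> M * (1 - cos (x - y))"
        unfolding cos_eq using M0 by (intro mult_left_mono) auto
      moreover have "M * (1 - cos d') = 2 * B"
        using cos_d' by (simp add: M_def)
      ultimately show ?thesis
        using B[of x] B[of y] e by linarith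
    qed
  qed
qed

text \<open>Integrating the estimate of \<open>periodic_modulus\<close> against the nonnegative
  kernel centred at \<open>\<theta>\<close> gives the error \<open>e / 2 + M * (1 - r)\<close>,
  which is independent of \<open>\<theta>\<close>.\<close>

lemma Re_herglotz_uniform_limit:
  fixes g :: "real \<Rightarrow> real"
  assumes g: "continuous_on UNIV g" "\<And>x. g (x + 2 * pi) = g x" and e: "0 < e"
  shows "\<forall>\<^sub>F r in at_left 1. \<forall>\<theta>. \<bar>Re (herglotz g (rcis r \<theta>)) - g \<theta>\<bar> \<le> e"
proof -
  obtain M where M: "0 \<le> M" "\<And>x y. \<bar>g x - g y\<bar> \<le> e / 2 + M * (1 - cos (x - y))"
    using periodic_modulus[OF g, of "e / 2"] e by auto
  have g': "continuous_on {-pi..pi} g"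
    using g(1) continuous_on_subset by blast
  have main: "\<bar>Re (herglotz g (rcis r \<theta>)) - g \<theta>\<bar> \<le> e / 2 + M * (1 - r)" if r: "0 < r" "r < 1" for r \<theta>
  proof -
    let ?K = "\<lambda>\<phi>. poisson_kernel r (\<phi> - \<theta>)"
    have z: "rcis r \<theta> \<in> ball 0 1"
      using r by simp
    note K = has_integral_poisson_kernel[OF r, of \<theta>]
    have 1: "((\<lambda>\<phi>. (g \<phi> - g \<theta>) * ?K \<phi>) has_integral (Re (herglotz g (rcis r \<theta>)) - g \<theta>)) {-pi..pi}"
      using has_integral_diff[OF has_integral_poisson_continuous[OF g' z] has_integral_mult_right[OF K(1), of "g \<theta>"]]
      by (simp add: algebra_simps)
    have 2: "((\<lambda>\<phi>. (e / 2 + M * (1 - cos (\<phi> - \<theta>))) * ?K \<phi>) has_integral (e / 2 + M * (1 - r))) {-pi..pi}"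
      using has_integral_add[OF has_integral_mult_right[OF K(1), of "e / 2"] has_integral_mult_right[OF K(2), of M]]
      by (simp add: algebra_simps)
    have bd: "\<bar>(g \<phi> - g \<theta>) * ?K \<phi>\<bar> \<le> (e / 2 + M * (1 - cos (\<phi> - \<theta>))) * ?K \<phi>" for \<phi>
      unfolding abs_mult using poisson_kernel_nonneg(1)[of r "\<phi> - \<theta>"] r M(2)[of \<phi> \<theta>]
      by (simp add: mult_right_mono)
    have "Re (herglotz g (rcis r \<theta>)) - g \<theta> \<le> e / 2 + M * (1 - r)"
      by (rule has_integral_le[OF 1 2]) (use bd in \<open>simp add: abs_le_iff\<close>)
    moreover have "- (Re (herglotz g (rcis r \<theta>)) - g \<theta>) \<le> e / 2 + M * (1 - r)"
      by (rule has_integral_le[OF has_integral_neg[OF 1] 2]) (use bd in \<open>simp only: abs_le_iff\<close>)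
    ultimately show ?thesis
      by (simp add: abs_le_iff)
  qed
  \<comment> \<open>For \<open>r > b\<close> the term \<open>M * (1 - r)\<close> is at most
    \<open>e / 2\<close>; \<open>M + 1\<close> avoids division by zero, and the maximum with 0
    ensures \<open>r > 0\<close>.\<close>
  define b where "b = max 0 (1 - e / (2 * (M + 1)))"
  have "b < 1"
    using e M(1) by (simp add: b_def)
  moreover have "\<bar>Re (herglotz g (rcis r \<theta>)) - g \<theta>\<bar> \<le> e" if r: "b < r" "r < 1" for r \<theta>
  proof -
    have "M * (1 - r) \<le> (M + 1) * (1 - r)"
      using r by (intro mult_right_mono) auto
    also have "\<dots> \<le> (M + 1) * (e / (2 * (M + 1)))"
      using r M(1) by (intro mult_left_mono) (auto simp: b_def)
    also have "\<dots> = e / 2"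
      using M(1) by (simp add: field_simps)
    finally show ?thesis
      using main[of r \<theta>] r by (simp add: b_def)
  qed
  ultimately show ?thesis
    unfolding eventually_at_left_field by blast
qed

subsection \<open>Harmonic functions and the maximum principle\<close>

lemma has_real_derivative_Re_holomorphic:
  assumes "G holomorphic_on S" "open S" "z \<in> S" and u: "\<And>z. z \<in> S \<Longrightarrow> u z = Re (G z)"
  shows "((\<lambda>t. u (z + t *\<^sub>R b)) has_real_derivative Re (b * deriv G z)) (at 0)"
proof -
  have "(G has_field_derivative deriv G z) (at (z + 0 *\<^sub>R b))"
    using holomorphic_derivI[OF assms(1-3)] by simp
  moreover have "((\<lambda>t. z + t *\<^sub>R b) has_vector_derivative b) (at 0)"
    by (auto intro!: derivative_eq_intros)
  ultimately have "((\<lambda>t. G (z + t *\<^sub>R b)) has_vector_derivative (b * deriv G z)) (at 0)"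
    using field_vector_diff_chain_at[of "\<lambda>t. z + t *\<^sub>R b" b 0 G "deriv G z"] by (simp add: o_def)
  then have D: "((\<lambda>t. Re (G (z + t *\<^sub>R b))) has_real_derivative Re (b * deriv G z)) (at 0)"
    by (rule has_field_derivative_Re)
  have "((\<lambda>t. z + t *\<^sub>R b) \<longlongrightarrow> z + 0 *\<^sub>R b) (nhds 0)"
    by (intro tendsto_intros filterlim_ident)
  \<comment> \<open>Since \<open>u\<close> agrees with \<open>Re (G z)\<close> only on
    \<open>S\<close>, openness is used to transfer the derivative.\<close>
  then have "\<forall>\<^sub>F t in nhds 0. z + t *\<^sub>R b \<in> S"
    using assms(2,3) by (auto elim: topological_tendstoD)
  then have "\<forall>\<^sub>F t in nhds 0. Re (G (z + t *\<^sub>R b)) = u (z + t *\<^sub>R b)"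
    by eventually_elim (simp add: u)
  from DERIV_cong_ev[OF refl this refl] D show ?thesis
    by blast
qed

lemma partial_deriv_Re_holomorphic:
  assumes "G holomorphic_on S" "open S" "z \<in> S" "\<And>z. z \<in> S \<Longrightarrow> u z = Re (G z)"
  shows "partial_deriv b u z = Re (b * deriv G z)"
  unfolding partial_deriv_def by (rule DERIV_imp_deriv[OF has_real_derivative_Re_holomorphic[OF assms]])

text \<open>The partial derivative of \<open>Re (G z)\<close> in direction \<open>b\<close> is the
  real part of the holomorphic function \<open>b * deriv G z\<close>, so the induction runs over all
  \<open>u\<close> and \<open>G\<close> at once.\<close>

lemma Ck_on_Re_holomorphic:
  assumes "G holomorphic_on S" "open S" "\<And>z. z \<in> S \<Longrightarrow> u z = Re (G z)"
  shows "Ck_on k u S"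
  using assms
proof (induction k arbitrary: u G)
  case 0
  have "continuous_on S (\<lambda>z. Re (G z))"
    by (intro continuous_intros holomorphic_on_imp_continuous_on 0)
  then have "continuous_on S u"
    by (rule continuous_on_eq) (simp add: 0)
  then show ?case by simp
next
  case (Suc k)
  have "continuous_on S (\<lambda>z. Re (G z))"
    by (intro continuous_intros holomorphic_on_imp_continuous_on Suc.prems)
  then have "continuous_on S u"
    by (rule continuous_on_eq) (simp add: Suc.prems)
  moreover have "Ck_on k (partial_deriv b u) S" for b
  proof (rule Suc.IH[OF _ Suc.prems(2)])
    show "(\<lambda>z. b * deriv G z) holomorphic_on S"
      by (intro holomorphic_intros holomorphic_deriv Suc.prems)
  qed (rule partial_deriv_Re_holomorphic[OF Suc.prems(1,2) _ Suc.prems(3)])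
  moreover have "(\<lambda>t. u (z + t *\<^sub>R b)) field_differentiable at 0" if "z \<in> S" for z b
    using has_real_derivative_Re_holomorphic[OF Suc.prems(1,2) that Suc.prems(3)]
    by (auto simp: field_differentiable_def)
  ultimately show ?case by simp
qed

lemma partial_deriv2_Re_holomorphic:
  assumes "G holomorphic_on S" "open S" "z \<in> S" "\<And>z. z \<in> S \<Longrightarrow> u z = Re (G z)"
  shows "partial_deriv b (partial_deriv b u) z = Re (b\<^sup>2 * deriv (deriv G) z)"
proof -
  have hol: "(\<lambda>z. b * deriv G z) holomorphic_on S"
    by (intro holomorphic_intros holomorphic_deriv assms)
  have "deriv (\<lambda>z. b * deriv G z) z = b * deriv (deriv G) z"
    by (rule DERIV_imp_deriv)
      (auto intro!: derivative_eq_intros holomorphic_derivI[OF _ assms(2,3)] holomorphic_deriv assms)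
  moreover have "partial_deriv b u w = Re (b * deriv G w)" if "w \<in> S" for w
    by (rule partial_deriv_Re_holomorphic[OF assms(1,2) that assms(4)])
  ultimately show ?thesis
    using partial_deriv_Re_holomorphic[OF hol assms(2,3), of "partial_deriv b u" b]
    by (simp add: power2_eq_square mult.assoc)
qed

text \<open>The squares of the basis vectors 1 and \<open>\<i>\<close> add up to 0.\<close>

lemma laplacian_Re_holomorphic:
  assumes "G holomorphic_on S" "open S" "z \<in> S" "\<And>z. z \<in> S \<Longrightarrow> u z = Re (G z)"
  shows "laplacian u z = 0"
  unfolding laplacian_def Basis_complex_def
  by (simp add: partial_deriv2_Re_holomorphic[OF assms])

text \<open>If \<open>q\<close> were positive, \<open>f'\<close> would vanish at 0 and be positive
  just to the right, so by the mean value theorem \<open>f\<close> would exceed its maximum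
  \<open>f 0\<close>.\<close>

lemma second_derivative_local_max:
  fixes f f' :: "real \<Rightarrow> real"
  assumes d: "0 < d" and max: "\<And>t. \<bar>t\<bar> < d \<Longrightarrow> f t \<le> f 0"
    and f: "\<And>t. \<bar>t\<bar> < d \<Longrightarrow> (f has_real_derivative f' t) (at t)"
    and f': "(f' has_real_derivative q) (at 0)"
  shows "q \<le> 0"
proof (rule ccontr)
  assume "\<not> q \<le> 0"
  then obtain e where e: "e > 0" "\<And>h. \<lbrakk>0 < h; h < e\<rbrakk> \<Longrightarrow> f' 0 < f' h"
    using DERIV_pos_inc_right[OF f'] by auto
  have "f' 0 = 0"
    by (rule DERIV_local_max[OF f d]) (use max d in auto)
  define h where "h = min d e / 2"
  have h: "0 < h" "h < d" "h < e"
    using d e(1) by (auto simp: h_def)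
  obtain s where s: "0 < s" "s < h" "f h - f 0 = (h - 0) * f' s"
    using MVT2[OF h(1), of f f'] f h by force
  have "0 < f' s"
    using e(2)[of s] s h \<open>f' 0 = 0\<close> by auto
  then have "0 < h * f' s"
    using h(1) by simp
  then show False
    using s(3) max[of h] h by simp
qed

text \<open>The weak maximum principle, with the boundary condition stated along spheres tending to
  the unit sphere, so that \<open>W\<close> is only considered inside the ball. Derivatives along
  the basis lines enter as explicit functions \<open>D\<close> and \<open>D'\<close>.\<close>

lemma harmonic_le_0:
  fixes W :: "'a::euclidean_space \<Rightarrow> real" and D D' :: "'a \<Rightarrow> 'a \<Rightarrow> real"
  assumes cont: "continuous_on (ball 0 1) W"
    and D: "\<And>x b. \<lbrakk>x \<in> ball 0 1; b \<in> Basis\<rbrakk> \<Longrightarrow> ((\<lambda>t. W (x + t *\<^sub>R b)) has_real_derivative D b x) (at 0)"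
    and D': "\<And>x b. \<lbrakk>x \<in> ball 0 1; b \<in> Basis\<rbrakk> \<Longrightarrow> ((\<lambda>t. D b (x + t *\<^sub>R b)) has_real_derivative D' b x) (at 0)"
    and harmonic: "\<And>x. x \<in> ball 0 1 \<Longrightarrow> (\<Sum>b\<in>Basis. D' b x) = 0"
    and boundary: "\<And>e. 0 < e \<Longrightarrow> \<forall>\<^sub>F r in at_left 1. \<forall>x. norm x = r \<longrightarrow> W x \<le> e"
    and x: "x \<in> ball 0 1"
  shows "W x \<le> 0"
proof (rule field_le_epsilon)
  fix e' :: real assume "0 < e'"
  define e where "e = e' / 2"
  have e: "0 < e"
    using \<open>0 < e'\<close> by (simp add: e_def)
  have "\<forall>\<^sub>F r in at_left 1. norm x < r \<and> r < 1"
    using x unfolding eventually_at_left_field by auto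
  then have "\<forall>\<^sub>F r in at_left 1. (\<forall>x. norm x = r \<longrightarrow> W x \<le> e) \<and> norm x < r \<and> r < 1"
    using boundary[OF e] by eventually_elim simp
  then obtain r where r: "\<And>x. norm x = r \<Longrightarrow> W x \<le> e" "norm x < r" "r < 1"
    using eventually_happens trivial_limit_at_left_real by blast
  \<comment> \<open>The quadratic term makes the Laplacian \<open>2 * e * DIM('a)\<close>, which is
    strictly positive and so excludes an interior maximum. It costs at most \<open>e\<close>, as
    does the bound on the sphere, whence \<open>e = e' / 2\<close>.\<close>
  define V where "V = (\<lambda>y. W y + e * (y \<bullet> y))"
  have "continuous_on (cball 0 r) V"
    unfolding V_def by (intro continuous_intros continuous_on_subset[OF cont]) (use r in auto)
  then obtain m where m: "m \<in> cball 0 r" "\<And>y. y \<in> cball 0 r \<Longrightarrow> V y \<le> V m"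
    using continuous_attains_sup[of "cball 0 r" V] r(2) norm_ge_zero[of x] by (metis cball_eq_empty compact_cball not_le order_less_trans order_le_less_trans)
  have "norm m = r"
  proof (rule ccontr)
    assume "norm m \<noteq> r"
    then have mr: "norm m < r"
      using m(1) by simp
    have line: "m + t *\<^sub>R b \<in> cball 0 r" "m + t *\<^sub>R b \<in> ball 0 1"
      if "\<bar>t\<bar> < r - norm m" "b \<in> Basis" for t b
      using norm_triangle_ineq[of m "t *\<^sub>R b"] that r(3) by auto
    have "D' b m + 2 * e \<le> 0" if b: "b \<in> Basis" for b
    proof (rule second_derivative_local_max[of "r - norm m" "\<lambda>t. V (m + t *\<^sub>R b)"])
      show "V (m + t *\<^sub>R b) \<le> V (m + 0 *\<^sub>R b)" if "\<bar>t\<bar> < r - norm m" for t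
        using m(2)[OF line(1)[OF that b]] by simp
      show "((\<lambda>t. V (m + t *\<^sub>R b)) has_real_derivative D b (m + t *\<^sub>R b) + e * (2 * (m \<bullet> b + t))) (at t)"
        if "\<bar>t\<bar> < r - norm m" for t
      proof -
        have "((\<lambda>s. W (m + t *\<^sub>R b + s *\<^sub>R b)) has_real_derivative D b (m + t *\<^sub>R b)) (at 0)"
          by (rule D[OF line(2)[OF that b] b])
        then have "((\<lambda>s. W (m + s *\<^sub>R b)) has_real_derivative D b (m + t *\<^sub>R b)) (at t)"
          using DERIV_shift[of "\<lambda>s. W (m + s *\<^sub>R b)" _ 0 t] by (simp add: algebra_simps)
        moreover have "((\<lambda>s. (m + s *\<^sub>R b) \<bullet> (m + s *\<^sub>R b)) has_real_derivative 2 * (m \<bullet> b + t)) (at t)"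
        proof -
          have "(\<lambda>s. (m + s *\<^sub>R b) \<bullet> (m + s *\<^sub>R b)) = (\<lambda>s. m \<bullet> m + 2 * s * (m \<bullet> b) + s\<^sup>2)"
            using b by (simp add: fun_eq_iff inner_add_left inner_add_right inner_commute power2_eq_square)
          then show ?thesis
            by (auto intro!: derivative_eq_intros)
        qed
        ultimately show ?thesis
          unfolding V_def by (intro DERIV_add DERIV_cmult)
      qed
      have "m \<in> ball 0 1"
        using mr r(3) by simp
      then show "((\<lambda>t. D b (m + t *\<^sub>R b) + e * (2 * (m \<bullet> b + t))) has_real_derivative D' b m + 2 * e) (at 0)"
        by (auto intro!: derivative_eq_intros D' b)
    qed (use mr in simp)
    then have "(\<Sum>b\<in>(Basis::'a set). D' b m + 2 * e) \<le> 0"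
      by (intro sum_nonpos)
    moreover have "(\<Sum>b\<in>(Basis::'a set). D' b m + 2 * e) = 2 * e * DIM('a)"
      using harmonic[of m] mr r(3) by (simp add: sum.distrib)
    ultimately show False
      using e by (simp add: mult_le_0_iff)
  qed
  then have "V m \<le> e + e * r\<^sup>2"
    using r(1)[of m] by (simp add: V_def power2_norm_eq_inner[symmetric])
  moreover have "e * r\<^sup>2 \<le> e * 1"
    using e r norm_ge_zero[of x] by (intro mult_left_mono power_le_one) linarith+
  moreover have "W x \<le> V x" "V x \<le> V m"
    using e m(2)[of x] r(2) by (auto simp: V_def)
  ultimately show "W x \<le> 0 + e'"
    by (simp add: e_def)
qed

subsection \<open>The Dirichlet problem\<close>

lemma has_vector_derivative_rcis:
  "(rcis r has_vector_derivative (\<i> * rcis r \<theta>)) (at \<theta> within A)"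
  unfolding has_vector_derivative_def rcis_def[abs_def]
  by (auto intro!: derivative_eq_intros simp: scaleR_conv_of_real)

lemma poisson_integral_dirichlet_solution:
  assumes f: "f \<in> HK"
  shows "dirichlet_solution f (poisson_integral f)"
proof -
  define c where "c = integral {-pi..pi} f / (2 * pi)"
  obtain F where F: "continuous_on UNIV F" "\<And>x. F (x + 2 * pi) = F x" "F (-pi) = 0"
    and prim: "\<And>a b. a \<le> b \<Longrightarrow> ((\<lambda>x. f x - c) has_integral (F b - F a)) {a..b}"
    using HK_periodic_primitive[OF f] unfolding c_def by blast
  have F': "continuous_on {-pi..pi} F"
    using F(1) continuous_on_subset by blast
  \<comment> \<open>A holomorphic function with real part \<open>poisson_integral f\<close>, which
    settles smoothness and harmonicity together.\<close>
  define G where "G = (\<lambda>z. of_real c + \<i> * z * deriv (herglotz F) z)"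
  have G: "G holomorphic_on ball 0 1"
    unfolding G_def by (intro holomorphic_intros holomorphic_deriv holomorphic_herglotz F' open_ball)
  have P: "poisson_integral f z = Re (G z)" if "z \<in> ball 0 1" for z
    unfolding poisson_integral_def
    using integral_unique[OF has_integral_poisson_HK[OF f c_def F prim that]] by (simp add: G_def)
  \<comment> \<open>On the circle of radius \<open>r\<close>,
    \<open>Re (herglotz F (rcis r \<theta>))\<close> is a primitive of the Poisson integral minus
    \<open>c\<close>, while \<open>F\<close> is one of \<open>f - c\<close>; the constant
    cancels.\<close>
  have int_P: "((\<lambda>\<theta>. poisson_integral f (rcis r \<theta>) - f \<theta>) has_integral
      ((Re (herglotz F (rcis r b)) - F b) - (Re (herglotz F (rcis r a)) - F a))) {a..b}"
    if r: "0 < r" "r < 1" and ab: "a \<le> b" for r a b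
  proof -
    have ball: "rcis r \<theta> \<in> ball 0 1" for \<theta>
      using r by simp
    have "((\<lambda>\<theta>. Re (\<i> * rcis r \<theta> * deriv (herglotz F) (rcis r \<theta>))) has_integral
        (Re (herglotz F (rcis r b)) - Re (herglotz F (rcis r a)))) {a..b}"
    proof (rule fundamental_theorem_of_calculus[OF ab])
      fix \<theta>
      have "((\<lambda>\<theta>. herglotz F (rcis r \<theta>)) has_vector_derivative \<i> * rcis r \<theta> * deriv (herglotz F) (rcis r \<theta>))
          (at \<theta> within {a..b})"
        using field_vector_diff_chain_within[OF has_vector_derivative_rcis
            has_field_derivative_at_within[OF holomorphic_derivI[OF holomorphic_herglotz[OF F'] open_ball ball]]]
        by (simp add: o_def)
      then show "((\<lambda>\<theta>. Re (herglotz F (rcis r \<theta>))) has_vector_derivative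
          Re (\<i> * rcis r \<theta> * deriv (herglotz F) (rcis r \<theta>))) (at \<theta> within {a..b})"
        unfolding has_real_derivative_iff_has_vector_derivative[symmetric] by (rule has_field_derivative_Re)
    qed
    from has_integral_diff[OF this prim[OF ab]] show ?thesis
      by (simp add: P[OF ball] G_def algebra_simps)
  qed
  have "((\<lambda>r. alexiewicz_norm (\<lambda>\<theta>. poisson_integral f (rcis r \<theta>) - f \<theta>)) \<longlongrightarrow> 0) (at_left 1)"
  proof (rule tendstoI)
    fix e :: real assume e: "0 < e"
    have "\<forall>\<^sub>F r in at_left 1. 0 < r \<and> r < (1::real)"
      unfolding eventually_at_left_field by (intro exI[of _ 0]) auto
    moreover have "\<forall>\<^sub>F r in at_left 1. \<forall>\<theta>. \<bar>Re (herglotz F (rcis r \<theta>)) - F \<theta>\<bar> \<le> e / 4"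
      by (rule Re_herglotz_uniform_limit[OF F(1,2)]) (use e in simp)
    ultimately show "\<forall>\<^sub>F r in at_left 1. dist (alexiewicz_norm (\<lambda>\<theta>. poisson_integral f (rcis r \<theta>) - f \<theta>)) 0 < e"
    proof eventually_elim
      case (elim r)
      have "\<bar>alexiewicz_norm (\<lambda>\<theta>. poisson_integral f (rcis r \<theta>) - f \<theta>)\<bar> \<le> e / 2"
      proof (rule abs_alexiewicz_norm_le)
        fix a b :: real assume ab: "a \<le> b" "b - a \<le> 2 * pi"
        have "integral {a..b} (\<lambda>\<theta>. poisson_integral f (rcis r \<theta>) - f \<theta>)
            = (Re (herglotz F (rcis r b)) - F b) - (Re (herglotz F (rcis r a)) - F a)"
          by (rule integral_unique[OF int_P]) (use elim ab in auto)
        moreover have "\<bar>Re (herglotz F (rcis r b)) - F b\<bar> \<le> e / 4" "\<bar>Re (herglotz F (rcis r a)) - F a\<bar> \<le> e / 4"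
          using elim by blast+
        ultimately show "\<bar>integral {a..b} (\<lambda>\<theta>. poisson_integral f (rcis r \<theta>) - f \<theta>)\<bar> \<le> e / 2"
          by linarith
      qed
      then show ?case
        using e by simp
    qed
  qed
  then show ?thesis
    unfolding dirichlet_solution_def
    using Ck_on_Re_holomorphic[OF G open_ball P] laplacian_Re_holomorphic[OF G open_ball _ P] by blast
qed

section \<open>Uniqueness by way of the Poisson formula\<close>

lemma Ck_on_2_line_derivatives:
  assumes u: "Ck_on 2 u S" and x: "x \<in> S" "b \<in> Basis"
  shows "((\<lambda>t. u (x + t *\<^sub>R b)) has_real_derivative partial_deriv b u x) (at 0)"
    and "((\<lambda>t. partial_deriv b u (x + t *\<^sub>R b)) has_real_derivative partial_deriv b (partial_deriv b u) x) (at 0)"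
  using assms unfolding numeral_2_eq_2 partial_deriv_def
  by (auto simp: DERIV_deriv_iff_field_differentiable partial_deriv_def[abs_def])

text \<open>The difference \<open>W\<close> of the two sides is harmonic in the disc and tends to 0
  uniformly at the circle, so the maximum principle applies to \<open>W\<close> and to
  \<open>- W\<close>. Taking \<open>R < 1\<close> makes the boundary data continuous.\<close>

lemma poisson_formula:
  fixes u :: "complex \<Rightarrow> real"
  assumes u: "Ck_on 2 u (ball 0 1)" "\<And>z. z \<in> ball 0 1 \<Longrightarrow> laplacian u z = 0"
    and R: "0 < R" "R < 1" and z: "z \<in> ball 0 1"
  shows "u (of_real R * z) = poisson_integral (\<lambda>\<theta>. u (rcis R \<theta>)) z"
proof -
  define g where "g = (\<lambda>\<theta>. u (rcis R \<theta>))"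
  have contu: "continuous_on (ball 0 1) u"
    using u(1) by (simp add: numeral_2_eq_2)
  have g: "continuous_on UNIV g" "\<And>x. g (x + 2 * pi) = g x"
    unfolding g_def
  proof -
    show "continuous_on UNIV (\<lambda>\<theta>. u (rcis R \<theta>))"
      unfolding rcis_def
      by (rule continuous_on_compose2[OF contu]) (use R in \<open>auto intro!: continuous_intros simp: norm_mult\<close>)
  qed (simp add: rcis_def cis.code)
  have g': "continuous_on {-pi..pi} g"
    using g(1) continuous_on_subset by blast
  note hol = holomorphic_herglotz[OF g']
  define W where "W = (\<lambda>z. u (of_real R * z) - Re (herglotz g z))"
  define D where "D = (\<lambda>b z. R * partial_deriv b u (of_real R * z) - partial_deriv b (\<lambda>z. Re (herglotz g z)) z)"
  define D' where "D' = (\<lambda>b z. R * (R * partial_deriv b (partial_deriv b u) (of_real R * z))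
      - partial_deriv b (partial_deriv b (\<lambda>z. Re (herglotz g z))) z)"
  have Rball: "of_real R * z \<in> ball 0 1" if "z \<in> ball 0 1" for z :: complex
    using that R mult_strict_mono[of R 1 "norm z" 1] by (simp add: norm_mult)
  have scale: "((\<lambda>t. v (of_real R * (x + t *\<^sub>R b))) has_real_derivative R * d) (at 0)"
    if "((\<lambda>t. v (of_real R * x + t *\<^sub>R b)) has_real_derivative d) (at 0)" for v :: "complex \<Rightarrow> real" and x b d
  proof -
    have "((\<lambda>t. v (of_real R * x + (R * t) *\<^sub>R b)) has_real_derivative d * R) (at 0)"
      using DERIV_chain2[of "\<lambda>t. v (of_real R * x + t *\<^sub>R b)" d "\<lambda>t. R * t" 0 R] that
      by (auto intro!: derivative_eq_intros)
    then show ?thesis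
      by (simp add: scaleR_conv_of_real algebra_simps)
  qed
  have h_C2: "Ck_on 2 (\<lambda>z. Re (herglotz g z)) (ball 0 1)"
    by (rule Ck_on_Re_holomorphic[OF hol]) auto
  have contW: "continuous_on (ball 0 1) W"
    unfolding W_def
    by (intro continuous_intros holomorphic_on_imp_continuous_on[OF hol] continuous_on_compose2[OF contu])
      (use Rball in auto)
  have DW: "((\<lambda>t. W (x + t *\<^sub>R b)) has_real_derivative D b x) (at 0)"
    "((\<lambda>t. D b (x + t *\<^sub>R b)) has_real_derivative D' b x) (at 0)"
    if "x \<in> ball 0 1" "b \<in> Basis" for x b
    unfolding W_def D_def D'_def
    by (intro DERIV_diff DERIV_cmult scale Ck_on_2_line_derivatives[OF u(1)] Ck_on_2_line_derivatives[OF h_C2] Rball that)+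
  have harm: "(\<Sum>b\<in>Basis. D' b x) = 0" if "x \<in> ball 0 1" for x
  proof -
    have "(\<Sum>b\<in>Basis. D' b x) = R * (R * laplacian u (of_real R * x)) - laplacian (\<lambda>z. Re (herglotz g z)) x"
      unfolding D'_def laplacian_def by (simp add: sum_subtractf sum_distrib_left)
    then show ?thesis
      using u(2)[OF Rball[OF that]] laplacian_Re_holomorphic[OF hol open_ball that] by simp
  qed
  have boundary: "\<forall>\<^sub>F r in at_left 1. \<forall>x. norm x = r \<longrightarrow> \<bar>W x\<bar> \<le> e" if e: "0 < e" for e
  proof -
    \<comment> \<open>The points \<open>rcis (R * r) \<theta>\<close> and
      \<open>rcis R \<theta>\<close> are \<open>R * (1 - r)\<close> apart, so uniform continuity
      controls the first term of \<open>W\<close> near the circle, uniformly in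
      \<open>\<theta>\<close>.\<close>
    have "uniformly_continuous_on (cball 0 R) u"
      by (rule compact_uniformly_continuous[OF continuous_on_subset[OF contu]]) (use R in auto)
    then obtain d where d: "d > 0"
      "\<And>s t. \<lbrakk>s \<in> cball 0 R; t \<in> cball 0 R; dist s t < d\<rbrakk> \<Longrightarrow> dist (u s) (u t) < e / 2"
      unfolding uniformly_continuous_on_def using e by (metis half_gt_zero)
    have "\<forall>\<^sub>F r in at_left 1. max 0 (1 - d) < r \<and> r < (1::real)"
      unfolding eventually_at_left_field using d(1) by (intro exI[of _ "max 0 (1 - d)"]) auto
    moreover have "\<forall>\<^sub>F r in at_left 1. \<forall>\<theta>. \<bar>Re (herglotz g (rcis r \<theta>)) - g \<theta>\<bar> \<le> e / 2"
      by (rule Re_herglotz_uniform_limit[OF g]) (use e in simp)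
    ultimately show ?thesis
    proof eventually_elim
      case (elim r)
      show ?case
      proof (intro allI impI)
        fix x :: complex assume norm_x: "norm x = r"
        define \<theta> where "\<theta> = Arg x"
        have x: "x = rcis r \<theta>"
          using norm_x by (auto simp: \<theta>_def rcis_cmod_Arg)
        have Rx: "of_real R * x = rcis (R * r) \<theta>"
          by (simp add: x rcis_def)
        have "dist (rcis (R * r) \<theta>) (rcis R \<theta>) = R * (1 - r)"
        proof -
          have "rcis (R * r) \<theta> - rcis R \<theta> = of_real (R * r - R) * cis \<theta>"
            by (simp add: rcis_def algebra_simps)
          then have "dist (rcis (R * r) \<theta>) (rcis R \<theta>) = \<bar>R * r - R\<bar>"
            by (simp only: dist_norm norm_mult norm_of_real norm_cis mult_1_right)
          also have "\<dots> = R * (1 - r)"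
            using R elim(1) by (simp add: abs_if algebra_simps)
          finally show ?thesis .
        qed
        also have "\<dots> \<le> 1 * (1 - r)"
          using R elim(1) by (intro mult_right_mono) auto
        also have "\<dots> < d"
          using elim(1) by simp
        finally have "dist (u (rcis (R * r) \<theta>)) (u (rcis R \<theta>)) < e / 2"
          using R elim(1) by (intro d(2)) (auto simp: abs_mult intro: mult_left_le)
        moreover have "\<bar>Re (herglotz g (rcis r \<theta>)) - g \<theta>\<bar> \<le> e / 2"
          using elim(2) by blast
        moreover have "W x = u (rcis (R * r) \<theta>) - Re (herglotz g (rcis r \<theta>))"
          unfolding W_def Rx by (simp add: x)
        ultimately show "\<bar>W x\<bar> \<le> e"
          unfolding g_def dist_real_def by linarith
      qed
    qed
  qed
  have "W z \<le> 0"
    by (rule harmonic_le_0[OF contW DW harm _ z], assumption+)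
      (rule eventually_mono[OF boundary], auto simp: abs_le_iff)
  moreover have "- W z \<le> 0"
  proof (rule harmonic_le_0[where W = "\<lambda>z. - W z" and D = "\<lambda>b z. - D b z" and D' = "\<lambda>b z. - D' b z"])
    show "(\<Sum>b\<in>Basis. - D' b x) = 0" if "x \<in> ball 0 1" for x
      using harm[OF that] by (simp add: sum_negf)
    show "\<forall>\<^sub>F r in at_left 1. \<forall>x. norm x = r \<longrightarrow> - W x \<le> e" if "0 < e" for e
      by (rule eventually_mono[OF boundary[OF that]]) (auto simp: abs_le_iff)
  qed (auto intro!: continuous_intros contW DERIV_minus DW z simp del: mem_ball mem_ball_0)
  ultimately have "u (of_real R * z) = Re (herglotz g z)"
    by (simp add: W_def)
  then show ?thesis
    using poisson_integral_eq_herglotz[OF g' z] by (simp add: g_def)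
qed

lemma dirichlet_solution_unique:
  assumes f: "f \<in> HK" and u: "dirichlet_solution f u" and z: "z \<in> ball 0 1"
  shows "u z = poisson_integral f z"
proof -
  have u_C2: "Ck_on 2 u (ball 0 1)" and harm: "\<And>z. z \<in> ball 0 1 \<Longrightarrow> laplacian u z = 0"
    and lim: "((\<lambda>r. alexiewicz_norm (\<lambda>\<theta>. u (rcis r \<theta>) - f \<theta>)) \<longlongrightarrow> 0) (at_left 1)"
    using u unfolding dirichlet_solution_def by auto
  have contu: "continuous_on (ball 0 1) u"
    using u_C2 by (simp add: numeral_2_eq_2)
  define C where "C = 1 + 4 / (1 - cmod z)\<^sup>2"
  have "\<forall>\<^sub>F R in at_left 1. 0 < R \<and> R < (1::real)"
    unfolding eventually_at_left_field by (intro exI[of _ 0]) auto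
  then have "\<forall>\<^sub>F R in at_left 1. norm (u (of_real R * z) - poisson_integral f z)
      \<le> C * alexiewicz_norm (\<lambda>\<theta>. u (rcis R \<theta>) - f \<theta>)"
  proof eventually_elim
    case (elim R)
    have uR: "(\<lambda>\<theta>. u (rcis R \<theta>)) \<in> HK"
    proof (rule HK_continuous)
      show "continuous_on UNIV (\<lambda>\<theta>. u (rcis R \<theta>))"
        unfolding rcis_def
        by (rule continuous_on_compose2[OF contu]) (use elim in \<open>auto intro!: continuous_intros simp: norm_mult\<close>)
    qed (simp add: rcis_def cis.code)
    \<comment> \<open>The Poisson formula on the smaller disc turns the pointwise error into the
      Poisson integral of the boundary error, whose Alexiewicz norm tends to 0.\<close>
    have "u (of_real R * z) - poisson_integral f z = poisson_integral (\<lambda>\<theta>. u (rcis R \<theta>) - f \<theta>) z"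
      using poisson_formula[OF u_C2 harm _ _ z, of R] poisson_integral_diff[OF uR f z] elim by simp
    then show ?case
      using abs_poisson_integral_le[OF HK_diff[OF uR f] z] by (simp add: C_def)
  qed
  moreover have "((\<lambda>R. C * alexiewicz_norm (\<lambda>\<theta>. u (rcis R \<theta>) - f \<theta>)) \<longlongrightarrow> 0) (at_left 1)"
    using tendsto_mult_right_zero[OF lim] .
  ultimately have "((\<lambda>R. u (of_real R * z) - poisson_integral f z) \<longlongrightarrow> 0) (at_left 1)"
    by (rule Lim_null_comparison)
  then have "((\<lambda>R. u (of_real R * z)) \<longlongrightarrow> poisson_integral f z) (at_left 1)"
    by (simp add: LIM_zero_iff)
  moreover have "((\<lambda>R. u (of_real R * z)) \<longlongrightarrow> u z) (at_left 1)"
  proof (rule isCont_tendsto_compose[where g = u])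
    show "isCont u z"
      using contu z continuous_on_eq_continuous_at open_ball by blast
    show "((\<lambda>R. of_real R * z) \<longlongrightarrow> z) (at_left 1)"
      by (auto intro!: tendsto_eq_intros)
  qed
  ultimately show ?thesis
    using tendsto_unique trivial_limit_at_left_real by blast
qed

theorem theorem10:
  fixes f :: "real \<Rightarrow> real"
  assumes "f \<in> HK"
  shows "dirichlet_solution f (poisson_integral f) \<and>
         (\<forall>u. dirichlet_solution f u \<longrightarrow> (\<forall>z\<in>ball 0 1. u z = poisson_integral f z))"
  using poisson_integral_dirichlet_solution dirichlet_solution_unique assms by blast

end
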